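(* The class of finite acyclic monic left locally totally ordered categories is closed under finite limits (taken in the category of small categories and functors). Consequently, any finite limit of weakly word-embeddable finite acyclic categories is weakly word-embeddable.
   Context: A finite category has finitely many objects and morphisms. A finite limit is a limit of a diagram indexed by a finite category; here the diagrams consist of categories in the stated class and arbitrary functors between them. A small category $\mathcal{C}$ is acyclic if for all distinct objects $c\neq d$, $\mathrm{Hom}(c,d)\neq\varnothing$ implies $\mathrm{Hom}(d,c)=\varnothing$, and $\mathrm{Hom}(c,c)=\{\mathrm{id}_c\}$ for every object $c$. A category is monic if every morphism is a monomorphism. A small category is left locally totally ordered if each hom-set $\mathrm{Hom}(c,d)$ can be equipped with a total order such that, for all objects $c,d,e$, every $g\colon d\to e$ and all $f_1,f_2\in\mathrm{Hom}(c,d)$, $f_1<f_2$ implies $g\circ f_1<g\circ f_2$. A word of length $n$ over an alphabet (set) $\Sigma$ is a function $w\colon[n]\to\Sigma$, where $[n]=\{1,\dots,n\}$. For words $w\colon[n]\to\Sigma$ and $w'\colon[m]\to\Sigma$, a subword inclusion $w'\to w$ is an injective order-preserving map $f\colon[m]\to[n]$ with $w\circ f=w'$. $\mathrm{Word}(\Sigma)$ is the category of words over $\Sigma$ and subword inclusions, and $\mathrm{Sub}_w$ is its full subcategory spanned by all words that admit a morphism into $w$. A category $\mathcal{D}$ is weakly word-embeddable if there exist an alphabet $\Sigma$, a word $w$ over $\Sigma$, and a functor $\mathcal{D}\to\mathrm{Sub}_w$ that is faithful and injective on objects. *)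

theory Defs
  imports "HOL-Library.FuncSet"
begin

section \<open>Categories and functors\<close>

record ('o, 'a) category =
  Obj :: "'o set"
  Arr :: "'a set"
  Dom :: "'a \<Rightarrow> 'o"
  Cod :: "'a \<Rightarrow> 'o"
  Ident :: "'o \<Rightarrow> 'a"
  Comp :: "'a \<Rightarrow> 'a \<Rightarrow> 'a"  \<comment> \<open>\<open>Comp C g f\<close> is "g after f"\<close>

definition Hom :: "('o, 'a) category \<Rightarrow> 'o \<Rightarrow> 'o \<Rightarrow> 'a set" where
  "Hom C c d = {f \<in> Arr C. Dom C f = c \<and> Cod C f = d}"

locale category =
  fixes C :: "('o, 'a) category"
  assumes Dom_Obj: "f \<in> Arr C \<Longrightarrow> Dom C f \<in> Obj C"
    and Cod_Obj: "f \<in> Arr C \<Longrightarrow> Cod C f \<in> Obj C"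
    and Ident_Hom: "c \<in> Obj C \<Longrightarrow> Ident C c \<in> Hom C c c"
    and Comp_Hom: "f \<in> Hom C c d \<Longrightarrow> g \<in> Hom C d e \<Longrightarrow> Comp C g f \<in> Hom C c e"
    and Comp_assoc: "f \<in> Hom C b c \<Longrightarrow> g \<in> Hom C c d \<Longrightarrow> h \<in> Hom C d e
          \<Longrightarrow> Comp C h (Comp C g f) = Comp C (Comp C h g) f"
    and Comp_Ident_right: "f \<in> Hom C c d \<Longrightarrow> Comp C f (Ident C c) = f"
    and Comp_Ident_left: "f \<in> Hom C c d \<Longrightarrow> Comp C (Ident C d) f = f"

record ('o1, 'a1, 'o2, 'a2) functor_maps =
  OMap :: "'o1 \<Rightarrow> 'o2"
  AMap :: "'a1 \<Rightarrow> 'a2"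

locale is_functor =
  source: category C + target: category D
  for C :: "('o1, 'a1) category" and D :: "('o2, 'a2) category" +
  fixes F :: "('o1, 'a1, 'o2, 'a2) functor_maps"
  assumes OMap_Obj: "c \<in> Obj C \<Longrightarrow> OMap F c \<in> Obj D"
    and AMap_Hom: "f \<in> Hom C c d \<Longrightarrow> AMap F f \<in> Hom D (OMap F c) (OMap F d)"
    and AMap_Ident: "c \<in> Obj C \<Longrightarrow> AMap F (Ident C c) = Ident D (OMap F c)"
    and AMap_Comp: "f \<in> Hom C c d \<Longrightarrow> g \<in> Hom C d e
          \<Longrightarrow> AMap F (Comp C g f) = Comp D (AMap F g) (AMap F f)"

definition faithful ::
  "('o1, 'a1) category \<Rightarrow> ('o1, 'a1, 'o2, 'a2) functor_maps \<Rightarrow> bool" where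
  "faithful C F \<longleftrightarrow> (\<forall>c \<in> Obj C. \<forall>d \<in> Obj C. inj_on (AMap F) (Hom C c d))"

definition full_subcategory :: "('o, 'a) category \<Rightarrow> 'o set \<Rightarrow> ('o, 'a) category" where
  "full_subcategory C S =
     C\<lparr>Obj := Obj C \<inter> S, Arr := {f \<in> Arr C. Dom C f \<in> S \<and> Cod C f \<in> S}\<rparr>"


section \<open>Limits\<close>

definition is_cone ::
  "('j, 'k) category \<Rightarrow> ('o, 'a) category \<Rightarrow> ('j, 'k, 'o, 'a) functor_maps
     \<Rightarrow> 'o \<Rightarrow> ('j \<Rightarrow> 'a) \<Rightarrow> bool" where
  "is_cone J K D L \<pi> \<longleftrightarrow>
     L \<in> Obj K \<and>
     (\<forall>i \<in> Obj J. \<pi> i \<in> Hom K L (OMap D i)) \<and>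
     (\<forall>u \<in> Arr J. Comp K (AMap D u) (\<pi> (Dom J u)) = \<pi> (Cod J u))"

definition is_limit ::
  "('j, 'k) category \<Rightarrow> ('o, 'a) category \<Rightarrow> ('j, 'k, 'o, 'a) functor_maps
     \<Rightarrow> 'o \<Rightarrow> ('j \<Rightarrow> 'a) \<Rightarrow> bool" where
  "is_limit J K D L \<pi> \<longleftrightarrow>
     is_cone J K D L \<pi> \<and>
     (\<forall>X \<rho>. is_cone J K D X \<rho> \<longrightarrow>
        (\<exists>!h. h \<in> Hom K X L \<and> (\<forall>i \<in> Obj J. Comp K (\<pi> i) h = \<rho> i)))"

text \<open>
  The limits are computed in the ambient category \<open>K\<close>; the first conjunct states that they
  exist there, the second that every limiting object has the property \<open>P\<close>.
\<close>

definition closed_under_limits ::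
  "('j, 'k) category \<Rightarrow> ('o, 'a) category \<Rightarrow> ('o \<Rightarrow> bool) \<Rightarrow> bool" where
  "closed_under_limits J K P \<longleftrightarrow>
     (\<forall>D. is_functor J K D \<and> (\<forall>i \<in> Obj J. P (OMap D i)) \<longrightarrow>
        (\<exists>L \<pi>. is_limit J K D L \<pi>) \<and> (\<forall>L \<pi>. is_limit J K D L \<pi> \<longrightarrow> P L))"


section \<open>The category of small categories\<close>

text \<open>
  The types \<open>'o\<close> and \<open>'a\<close> play the role of the universe: a category is small if its objects and
  arrows form sets in these types. The maps of a functor are taken to be extensional, so that
  equality of arrows is equality of functors.
\<close>

definition id_functor :: "('o, 'a) category \<Rightarrow> ('o, 'a, 'o, 'a) functor_maps" where
  "id_functor C = \<lparr>OMap = restrict id (Obj C), AMap = restrict id (Arr C)\<rparr>"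

definition comp_functor ::
  "('o1, 'a1) category \<Rightarrow> ('o2, 'a2, 'o3, 'a3) functor_maps
     \<Rightarrow> ('o1, 'a1, 'o2, 'a2) functor_maps \<Rightarrow> ('o1, 'a1, 'o3, 'a3) functor_maps" where
  "comp_functor C G F =
     \<lparr>OMap = compose (Obj C) (OMap G) (OMap F), AMap = compose (Arr C) (AMap G) (AMap F)\<rparr>"

type_synonym ('o, 'a) functor_arrow =
  "('o, 'a) category \<times> ('o, 'a, 'o, 'a) functor_maps \<times> ('o, 'a) category"

definition small_Cat :: "(('o, 'a) category, ('o, 'a) functor_arrow) category" where
  "small_Cat =
     \<lparr>Obj = {C. category C},
      Arr = {(C, F, D). is_functor C D F \<and>
               OMap F \<in> extensional (Obj C) \<and> AMap F \<in> extensional (Arr C)},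
      Dom = (\<lambda>(C, F, D). C),
      Cod = (\<lambda>(C, F, D). D),
      Ident = (\<lambda>C. (C, id_functor C, C)),
      Comp = (\<lambda>(D', G, E) (C, F, D). (C, comp_functor C G F, E))\<rparr>"

lemma category_small_Cat: "category (small_Cat :: (('o, 'a) category, _) category)"
proof -
  have H: "(X \<in> Hom small_Cat C D) \<longleftrightarrow> (\<exists>F. X = (C, F, D) \<and> is_functor C D F \<and>
     OMap F \<in> extensional (Obj C) \<and> AMap F \<in> extensional (Arr C))" for X and C D :: "('o, 'a) category"
    by (auto simp: Hom_def small_Cat_def)
  have HA: "f \<in> Hom C c d \<Longrightarrow> f \<in> Arr C" for C :: "('o, 'a) category" and f c d
    by (auto simp: Hom_def)
  have AH: "f \<in> Arr C \<Longrightarrow> f \<in> Hom C (Dom C f) (Cod C f)" for C :: "('o, 'a) category" and f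
    by (auto simp: Hom_def)
  have AA: "is_functor C D F \<Longrightarrow> f \<in> Arr C \<Longrightarrow> AMap F f \<in> Arr D"
    for C D :: "('o, 'a) category" and f F
    using is_functor.AMap_Hom AH HA by metis
  have I: "is_functor C C (id_functor C)" if "category C" for C :: "('o, 'a) category"
  proof -
    interpret category C by fact
    show ?thesis
      using Ident_Hom Comp_Hom Dom_Obj Cod_Obj
      by unfold_locales (auto simp: id_functor_def Hom_def)
  qed
  have K: "is_functor C E (comp_functor C G F)" if "is_functor C D F" "is_functor D E G"
    for C D E :: "('o, 'a) category" and F G
  proof -
    interpret F: is_functor C D F by fact
    interpret G: is_functor D E G by fact
    have [simp]: "OMap (comp_functor C G F) c = OMap G (OMap F c)" if "c \<in> Obj C" for c
      using that by (simp add: comp_functor_def compose_def)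
    have [simp]: "AMap (comp_functor C G F) f = AMap G (AMap F f)" if "f \<in> Hom C c d" for f c d
      using HA[OF that] by (simp add: comp_functor_def compose_def)
    have O: "c \<in> Obj C" "d \<in> Obj C" if "f \<in> Hom C c d" for f c d
      using that F.source.Dom_Obj F.source.Cod_Obj by (auto simp: Hom_def)
    show ?thesis
    proof
      fix f c d assume f: "f \<in> Hom C c d"
      show "AMap (comp_functor C G F) f \<in> Hom E (OMap (comp_functor C G F) c) (OMap (comp_functor C G F) d)"
        using f O[OF f] F.AMap_Hom G.AMap_Hom by simp
      fix g e assume g: "g \<in> Hom C d e"
      show "AMap (comp_functor C G F) (Comp C g f) =
        Comp E (AMap (comp_functor C G F) g) (AMap (comp_functor C G F) f)"
        using f g F.source.Comp_Hom[OF f g] F.AMap_Comp[OF f g]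
          G.AMap_Comp[OF F.AMap_Hom[OF f] F.AMap_Hom[OF g]] by simp
    next
      fix c assume c: "c \<in> Obj C"
      show "AMap (comp_functor C G F) (Ident C c) = Ident E (OMap (comp_functor C G F) c)"
        using c F.source.Ident_Hom[OF c] F.AMap_Ident G.AMap_Ident F.OMap_Obj by simp
    qed (simp add: F.OMap_Obj G.OMap_Obj)
  qed
  show ?thesis
  proof
    fix X :: "('o, 'a) functor_arrow" assume "X \<in> Arr small_Cat"
    then show "Dom small_Cat X \<in> Obj small_Cat" "Cod small_Cat X \<in> Obj small_Cat"
      by (auto simp: small_Cat_def is_functor_def)
  next
    fix C :: "('o, 'a) category" assume "C \<in> Obj small_Cat"
    then show "Ident small_Cat C \<in> Hom small_Cat C C"
      using I by (simp add: H) (simp add: small_Cat_def id_functor_def)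
  next
    fix X Y and C D E :: "('o, 'a) category" assume "X \<in> Hom small_Cat C D" "Y \<in> Hom small_Cat D E"
    then show "Comp small_Cat Y X \<in> Hom small_Cat C E"
      unfolding H by (auto simp: small_Cat_def K) (auto simp: comp_functor_def)
  next
    fix X Y Z and B C D E :: "('o, 'a) category"
    assume "X \<in> Hom small_Cat B C" "Y \<in> Hom small_Cat C D" "Z \<in> Hom small_Cat D E"
    then show "Comp small_Cat Z (Comp small_Cat Y X) = Comp small_Cat (Comp small_Cat Z Y) X"
      unfolding H
      by (auto simp: small_Cat_def comp_functor_def compose_def fun_eq_iff
        dest: is_functor.OMap_Obj AA)
  next
    fix X and C D :: "('o, 'a) category" assume "X \<in> Hom small_Cat C D"
    then obtain F where X: "X = (C, F, D)" "is_functor C D F"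
      "OMap F \<in> extensional (Obj C)" "AMap F \<in> extensional (Arr C)"
      unfolding H by blast
    interpret F: is_functor C D F by fact
    have "comp_functor C F (id_functor C) = F"
      using X by (cases F) (auto simp: comp_functor_def id_functor_def compose_def
        extensional_def fun_eq_iff)
    then show "Comp small_Cat X (Ident small_Cat C) = X"
      by (simp add: X small_Cat_def)
    have "comp_functor C (id_functor D) F = F"
      using X F.OMap_Obj AA[OF X(2)] by (cases F) (auto simp: comp_functor_def id_functor_def
        compose_def extensional_def fun_eq_iff)
    then show "Comp small_Cat (Ident small_Cat D) X = X"
      by (simp add: X small_Cat_def)
  qed
qed


section \<open>Classes of categories\<close>

definition finite_category :: "('o, 'a) category \<Rightarrow> bool" where
  "finite_category C \<longleftrightarrow> category C \<and> finite (Obj C) \<and> finite (Arr C)"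

definition acyclic_category :: "('o, 'a) category \<Rightarrow> bool" where
  "acyclic_category C \<longleftrightarrow>
     category C \<and>
     (\<forall>c \<in> Obj C. \<forall>d \<in> Obj C. c \<noteq> d \<longrightarrow> Hom C c d \<noteq> {} \<longrightarrow> Hom C d c = {}) \<and>
     (\<forall>c \<in> Obj C. Hom C c c = {Ident C c})"

definition is_mono :: "('o, 'a) category \<Rightarrow> 'a \<Rightarrow> bool" where
  "is_mono C g \<longleftrightarrow>
     g \<in> Arr C \<and>
     (\<forall>c \<in> Obj C. \<forall>f1 \<in> Hom C c (Dom C g). \<forall>f2 \<in> Hom C c (Dom C g).
        Comp C g f1 = Comp C g f2 \<longrightarrow> f1 = f2)"

definition monic_category :: "('o, 'a) category \<Rightarrow> bool" where
  "monic_category C \<longleftrightarrow> category C \<and> (\<forall>g \<in> Arr C. is_mono C g)"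

text \<open>\<open>R c d\<close> is the reflexive order on \<open>Hom C c d\<close>; its strict part is \<open>R c d - Id\<close>.\<close>

definition left_locally_totally_ordered :: "('o, 'a) category \<Rightarrow> bool" where
  "left_locally_totally_ordered C \<longleftrightarrow>
     category C \<and>
     (\<exists>R :: 'o \<Rightarrow> 'o \<Rightarrow> 'a rel.
        (\<forall>c \<in> Obj C. \<forall>d \<in> Obj C. linear_order_on (Hom C c d) (R c d)) \<and>
        (\<forall>c \<in> Obj C. \<forall>d \<in> Obj C. \<forall>e \<in> Obj C.
           \<forall>g \<in> Hom C d e. \<forall>f1 \<in> Hom C c d. \<forall>f2 \<in> Hom C c d.
             (f1, f2) \<in> R c d - Id \<longrightarrow> (Comp C g f1, Comp C g f2) \<in> R c e - Id))"


section \<open>Words and subword inclusions\<close>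

text \<open>
  A word over \<open>\<Sigma>\<close> is a list, hence its positions are numbered from 0. A subword inclusion is
  recorded together with its source and target.
\<close>

definition subword_inclusions :: "'s list \<Rightarrow> 's list \<Rightarrow> (nat \<Rightarrow> nat) set" where
  "subword_inclusions v w =
     {f \<in> {..<length v} \<rightarrow>\<^sub>E {..<length w}.
        inj_on f {..<length v} \<and> mono_on {..<length v} f \<and> (\<forall>i < length v. w ! f i = v ! i)}"

type_synonym 's word_arrow = "'s list \<times> (nat \<Rightarrow> nat) \<times> 's list"

definition Word :: "'s set \<Rightarrow> ('s list, 's word_arrow) category" where
  "Word \<Sigma> =
     \<lparr>Obj = lists \<Sigma>,
      Arr = {(v, f, w). v \<in> lists \<Sigma> \<and> w \<in> lists \<Sigma> \<and> f \<in> subword_inclusions v w},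
      Dom = (\<lambda>(v, f, w). v),
      Cod = (\<lambda>(v, f, w). w),
      Ident = (\<lambda>w. (w, restrict id {..<length w}, w)),
      Comp = (\<lambda>(v', g, w) (u, f, v). (u, compose {..<length u} g f, w))\<rparr>"

definition Sub :: "'s set \<Rightarrow> 's list \<Rightarrow> ('s list, 's word_arrow) category" where
  "Sub \<Sigma> w = full_subcategory (Word \<Sigma>) {v \<in> Obj (Word \<Sigma>). Hom (Word \<Sigma>) v w \<noteq> {}}"

lemma category_Word: "category (Word \<Sigma>)"
proof -
  have H: "X \<in> Hom (Word \<Sigma>) v w \<longleftrightarrow> (\<exists>f. X = (v, f, w) \<and> v \<in> lists \<Sigma> \<and> w \<in> lists \<Sigma> \<and>
      f \<in> subword_inclusions v w)" for X v w
    by (auto simp: Hom_def Word_def)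
  have K: "compose {..<length u} g f \<in> subword_inclusions u w"
    if f: "f \<in> subword_inclusions u v" and g: "g \<in> subword_inclusions v w" for f g and u v w :: "'a list"
  proof -
    have fm: "f i < length v" if "i < length u" for i
      using f that by (auto simp: subword_inclusions_def PiE_def Pi_def)
    have "inj_on (compose {..<length u} g f) {..<length u}"
      using f g fm by (auto simp: subword_inclusions_def inj_on_def compose_def)
    moreover have "mono_on {..<length u} (compose {..<length u} g f)"
      using f g fm by (auto simp: subword_inclusions_def monotone_on_def compose_def)
    ultimately show ?thesis
      using f g fm by (auto simp: subword_inclusions_def compose_def)
  qed
  show ?thesis
  proof
    fix X assume "X \<in> Arr (Word \<Sigma>)"
    then show "Dom (Word \<Sigma>) X \<in> Obj (Word \<Sigma>)" "Cod (Word \<Sigma>) X \<in> Obj (Word \<Sigma>)"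
      by (auto simp: Word_def)
  next
    fix w assume "w \<in> Obj (Word \<Sigma>)"
    then show "Ident (Word \<Sigma>) w \<in> Hom (Word \<Sigma>) w w"
      unfolding H by (auto simp: Word_def subword_inclusions_def monotone_on_def inj_on_def)
  next
    fix X Y u v w assume "X \<in> Hom (Word \<Sigma>) u v" "Y \<in> Hom (Word \<Sigma>) v w"
    then show "Comp (Word \<Sigma>) Y X \<in> Hom (Word \<Sigma>) u w"
      unfolding H using K by (fastforce simp: Word_def)
  next
    fix X Y Z t u v w
    assume "X \<in> Hom (Word \<Sigma>) t u" "Y \<in> Hom (Word \<Sigma>) u v" "Z \<in> Hom (Word \<Sigma>) v w"
    then show "Comp (Word \<Sigma>) Z (Comp (Word \<Sigma>) Y X) = Comp (Word \<Sigma>) (Comp (Word \<Sigma>) Z Y) X"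
      unfolding H
      by (auto simp: Word_def subword_inclusions_def compose_def fun_eq_iff PiE_def Pi_def)
  next
    fix X v w assume "X \<in> Hom (Word \<Sigma>) v w"
    then show "Comp (Word \<Sigma>) X (Ident (Word \<Sigma>) v) = X" "Comp (Word \<Sigma>) (Ident (Word \<Sigma>) w) X = X"
      unfolding H
      by (auto simp: Word_def subword_inclusions_def compose_def fun_eq_iff PiE_def Pi_def
        extensional_def)
  qed
qed

lemma category_Sub: "category (Sub \<Sigma> w)"
proof -
  interpret W: category "Word \<Sigma>" by (rule category_Word)
  show ?thesis
    using W.Ident_Hom W.Comp_Hom W.Comp_assoc W.Comp_Ident_right W.Comp_Ident_left
      W.Dom_Obj W.Cod_Obj
    unfolding Sub_def full_subcategory_def by unfold_locales (auto simp: Hom_def)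
qed

text \<open>The type argument is the type from which the letters of the alphabet are drawn.\<close>

definition weakly_word_embeddable :: "'s itself \<Rightarrow> ('o, 'a) category \<Rightarrow> bool" where
  "weakly_word_embeddable (_ :: 's itself) C \<longleftrightarrow>
     (\<exists>(\<Sigma> :: 's set) w F. w \<in> lists \<Sigma> \<and> is_functor C (Sub \<Sigma> w) F \<and>
        faithful C F \<and> inj_on (OMap F) (Obj C))"

end

theory Submission
  imports Defs
begin

text \<open>
  The legs of a limit in the category of small categories jointly separate arrows, hence also
  objects. Finiteness, acyclicity and monicity can therefore be checked in the vertices of the
  diagram, and the hom-sets of the limit are ordered lexicographically along an enumeration of the
  index objects; left composition cannot change the first coordinate at which two arrows differ,
  since it is strictly monotone, hence injective, there. If every vertex embeds into words, then
  concatenating the words assigned by the different legs, over disjoint copies of the alphabet,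
  embeds the limit; the characterization of weakly word-embeddable categories by local total orders
  is not needed. The limit itself exists because the compatible families of objects and arrows are
  finite in number and so can be encoded in any infinite type.
\<close>

section \<open>Hom-sets and images of arrows under functors\<close>

lemma Hom_Dom_Cod:
  assumes "category C" and "f \<in> Hom C c d"
  shows "f \<in> Arr C" and "Dom C f = c" and "Cod C f = d" and "c \<in> Obj C" and "d \<in> Obj C"
  using assms category.Dom_Obj category.Cod_Obj by (fastforce simp: Hom_def)+

lemma Arr_Hom: "f \<in> Arr C \<Longrightarrow> f \<in> Hom C (Dom C f) (Cod C f)"
  by (simp add: Hom_def)

lemma (in is_functor) AMap_Arr:
  assumes "f \<in> Arr C"
  shows "AMap F f \<in> Arr D" and "Dom D (AMap F f) = OMap F (Dom C f)"
    and "Cod D (AMap F f) = OMap F (Cod C f)"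
  using AMap_Hom[OF Arr_Hom[OF assms]] by (auto simp: Hom_def)

section \<open>Jointly faithful families of functors\<close>

text \<open>This is what the transfer results extract from a limit cone: finitely many functors that
  together separate arrows. Separation ranges over all pairs of arrows, not only parallel ones, and
  so reaches objects through their identities.\<close>

locale jointly_faithful = category L
  for L :: "('o, 'a) category" +
  fixes I :: "'i set" and E :: "'i \<Rightarrow> ('p, 'b) category"
    and F :: "'i \<Rightarrow> ('o, 'a, 'p, 'b) functor_maps"
  assumes functors: "i \<in> I \<Longrightarrow> is_functor L (E i) (F i)"
    and joint_Arr: "f \<in> Arr L \<Longrightarrow> g \<in> Arr L \<Longrightarrow> (\<And>i. i \<in> I \<Longrightarrow> AMap (F i) f = AMap (F i) g) \<Longrightarrow> f = g"
    and finite_index: "finite I"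
begin

lemma Ident_inj: "inj_on (Ident L) (Obj L)"
  by (rule inj_on_inverseI[where g = "Dom L"]) (use Ident_Hom in \<open>auto simp: Hom_def\<close>)

text \<open>Functors preserve identities, so the identities of the two objects have equal images
  under every leg and hence coincide; an object is the domain of its identity.\<close>

lemma joint_Obj:
  assumes "c \<in> Obj L" "d \<in> Obj L" and eq: "\<And>i. i \<in> I \<Longrightarrow> OMap (F i) c = OMap (F i) d"
  shows "c = d"
proof -
  have "Ident L c = Ident L d"
  proof (rule joint_Arr)
    show "Ident L c \<in> Arr L" "Ident L d \<in> Arr L"
      using Ident_Hom assms(1,2) by (auto simp: Hom_def)
    show "AMap (F i) (Ident L c) = AMap (F i) (Ident L d)" if "i \<in> I" for i
      using is_functor.AMap_Ident[OF functors[OF that]] assms(1,2) eq[OF that] by simp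
  qed
  then show ?thesis
    using Ident_inj assms(1,2) by (simp add: inj_on_def)
qed

text \<open>The tuple of images embeds the arrows into a finite product of finite sets, and
  identities embed the objects into the arrows.\<close>

lemma finite_category_source:
  assumes fin: "\<And>i. i \<in> I \<Longrightarrow> finite_category (E i)"
  shows "finite_category L"
proof -
  have "finite (\<Pi>\<^sub>E i\<in>I. Arr (E i))"
    using fin finite_index by (intro finite_PiE) (auto simp: finite_category_def)
  moreover have "(\<lambda>f. \<lambda>i\<in>I. AMap (F i) f) ` Arr L \<subseteq> (\<Pi>\<^sub>E i\<in>I. Arr (E i))"
    using is_functor.AMap_Arr(1)[OF functors] by (auto intro!: restrict_PiE_iff[THEN iffD2])
  moreover have "inj_on (\<lambda>f. \<lambda>i\<in>I. AMap (F i) f) (Arr L)"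
    by (intro inj_onI joint_Arr) (auto simp: fun_eq_iff restrict_def split: if_splits)
  ultimately have A: "finite (Arr L)"
    by (meson finite_imageD finite_subset)
  moreover have "Ident L ` Obj L \<subseteq> Arr L"
    using Ident_Hom by (auto simp: Hom_def)
  ultimately have "finite (Obj L)"
    using Ident_inj by (meson finite_imageD finite_subset)
  with A show ?thesis
    by (simp add: finite_category_def category_axioms)
qed

text \<open>Some leg keeps two distinct objects distinct, and arrows in both directions would
  survive there. An endomorphism becomes an identity under every leg, so separation makes it an
  identity.\<close>

lemma acyclic_category_source:
  assumes acyc: "\<And>i. i \<in> I \<Longrightarrow> acyclic_category (E i)"
  shows "acyclic_category L"
  unfolding acyclic_category_def
proof (intro conjI ballI impI)
  fix c d assume cd: "c \<in> Obj L" "d \<in> Obj L" "c \<noteq> d" "Hom L c d \<noteq> {}"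
  then obtain i where i: "i \<in> I" "OMap (F i) c \<noteq> OMap (F i) d"
    using joint_Obj by blast
  interpret Fi: is_functor L "E i" "F i" using functors i by blast
  have "Hom (E i) (OMap (F i) c) (OMap (F i) d) \<noteq> {}"
    using cd(4) Fi.AMap_Hom by blast
  then have "Hom (E i) (OMap (F i) d) (OMap (F i) c) = {}"
    using acyc[OF i(1)] i cd Fi.OMap_Obj by (auto simp: acyclic_category_def)
  then show "Hom L d c = {}"
    using Fi.AMap_Hom by blast
next
  fix c assume c: "c \<in> Obj L"
  have "f = Ident L c" if f: "f \<in> Hom L c c" for f
  proof (rule joint_Arr)
    show "f \<in> Arr L" "Ident L c \<in> Arr L" using f Ident_Hom[OF c] by (auto simp: Hom_def)
    fix i assume i: "i \<in> I"
    interpret Fi: is_functor L "E i" "F i" using functors i by blast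
    show "AMap (F i) f = AMap (F i) (Ident L c)"
      using acyc[OF i] Fi.AMap_Hom[OF f] Fi.OMap_Obj[OF c] Fi.AMap_Ident[OF c]
      by (simp add: acyclic_category_def)
  qed
  then show "Hom L c c = {Ident L c}"
    using Ident_Hom[OF c] by blast
qed (rule category_axioms)

text \<open>Cancelling the image of \<open>g\<close> in each target shows that all legs agree on
  \<open>f1\<close> and \<open>f2\<close>.\<close>

lemma monic_category_source:
  assumes mon: "\<And>i. i \<in> I \<Longrightarrow> monic_category (E i)"
  shows "monic_category L"
  unfolding monic_category_def is_mono_def
proof (intro conjI ballI impI)
  fix g c f1 f2
  assume g: "g \<in> Arr L" and c: "c \<in> Obj L"
    and f: "f1 \<in> Hom L c (Dom L g)" "f2 \<in> Hom L c (Dom L g)" and eq: "Comp L g f1 = Comp L g f2"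
  show "f1 = f2"
  proof (rule joint_Arr)
    show "f1 \<in> Arr L" "f2 \<in> Arr L" using f by (auto simp: Hom_def)
    fix i assume i: "i \<in> I"
    interpret Fi: is_functor L "E i" "F i" using functors i by blast
    have "is_mono (E i) (AMap (F i) g)"
      using mon[OF i] Fi.AMap_Arr(1)[OF g] by (simp add: monic_category_def)
    moreover have "Comp (E i) (AMap (F i) g) (AMap (F i) f1) = Comp (E i) (AMap (F i) g) (AMap (F i) f2)"
      using Fi.AMap_Comp[OF f(1) Arr_Hom[OF g]] Fi.AMap_Comp[OF f(2) Arr_Hom[OF g]] eq by simp
    ultimately show "AMap (F i) f1 = AMap (F i) f2"
      using Fi.AMap_Hom[OF f(1)] Fi.AMap_Hom[OF f(2)] Fi.OMap_Obj[OF c] Fi.AMap_Arr(2)[OF g]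
      by (auto simp: is_mono_def)
  qed
qed (simp_all add: category_axioms)

lemma left_locally_totally_ordered_source:
  assumes ord: "\<And>i. i \<in> I \<Longrightarrow> left_locally_totally_ordered (E i)"
  shows "left_locally_totally_ordered L"
proof -
  \<comment> \<open>Orders are chosen for all targets at once, so that one family \<open>R\<close>
    can be compared coordinatewise.\<close>
  have "\<exists>R. \<forall>i\<in>I.
      (\<forall>c \<in> Obj (E i). \<forall>d \<in> Obj (E i). linear_order_on (Hom (E i) c d) (R i c d)) \<and>
      (\<forall>c \<in> Obj (E i). \<forall>d \<in> Obj (E i). \<forall>e \<in> Obj (E i).
         \<forall>g \<in> Hom (E i) d e. \<forall>f1 \<in> Hom (E i) c d. \<forall>f2 \<in> Hom (E i) c d.
           (f1, f2) \<in> R i c d - Id \<longrightarrow> (Comp (E i) g f1, Comp (E i) g f2) \<in> R i c e - Id)"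
    using ord unfolding left_locally_totally_ordered_def by (intro bchoice) blast
  then obtain R where
    lin: "\<And>i c d. i \<in> I \<Longrightarrow> c \<in> Obj (E i) \<Longrightarrow> d \<in> Obj (E i) \<Longrightarrow> linear_order_on (Hom (E i) c d) (R i c d)"
    and pres: "\<And>i c d e g f1 f2. i \<in> I \<Longrightarrow> c \<in> Obj (E i) \<Longrightarrow> d \<in> Obj (E i) \<Longrightarrow> e \<in> Obj (E i) \<Longrightarrow>
      g \<in> Hom (E i) d e \<Longrightarrow> f1 \<in> Hom (E i) c d \<Longrightarrow> f2 \<in> Hom (E i) c d \<Longrightarrow>
      (f1, f2) \<in> R i c d - Id \<Longrightarrow> (Comp (E i) g f1, Comp (E i) g f2) \<in> R i c e - Id"
    by metis
  \<comment> \<open>Finiteness of \<open>I\<close> provides an enumeration, which fixes the order in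
    which coordinates are compared.\<close>
  obtain pos :: "'i \<Rightarrow> nat" where pos: "inj_on pos I"
    using finite_index by (meson finite_imp_inj_to_nat_seg)
  \<comment> \<open>Here \<open>i\<close> is the first coordinate at which the arrows differ, and
    the order increases strictly there.\<close>
  define less where "less c d f f' i \<longleftrightarrow>
      (AMap (F i) f, AMap (F i) f') \<in> R i (OMap (F i) c) (OMap (F i) d) - Id \<and>
      (\<forall>j\<in>I. pos j < pos i \<longrightarrow> AMap (F j) f = AMap (F j) f')" for c d f f' i
  define Q where "Q c d = {(f, f'). f \<in> Hom L c d \<and> f' \<in> Hom L c d \<and>
      (f = f' \<or> (\<exists>i\<in>I. less c d f f' i))}" for c d
  \<comment> \<open>Transitivity of the strict part: if the outer images were equal, antisymmetry
    would identify the middle one with them.\<close>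
  have strict: "(AMap (F i) f, AMap (F i) f'') \<in> R i (OMap (F i) c) (OMap (F i) d) - Id"
    if "i \<in> I" "c \<in> Obj L" "d \<in> Obj L"
      "(AMap (F i) f, AMap (F i) f') \<in> R i (OMap (F i) c) (OMap (F i) d) - Id"
      "(AMap (F i) f', AMap (F i) f'') \<in> R i (OMap (F i) c) (OMap (F i) d) - Id" for i c d f f' f''
    using lin[OF that(1) is_functor.OMap_Obj[OF functors[OF that(1)] that(2)]
        is_functor.OMap_Obj[OF functors[OF that(1)] that(3)]] that(4,5)
    by (auto simp: linear_order_on_def partial_order_on_def preorder_on_def
        dest: transD antisymD)
  have less_chain: "\<exists>i\<in>I. less c d f f'' i"
    if "i \<in> I" "j \<in> I" "c \<in> Obj L" "d \<in> Obj L" "less c d f f' i" "less c d f' f'' j" for c d f f' f'' i j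
  proof -
    \<comment> \<open>The outer arrows first differ at the earlier of the two positions, where one
      comparison is strict and the other an equality; if the positions coincide,
      \<open>strict\<close> applies.\<close>
    consider "pos i < pos j" | "pos j < pos i" | "i = j"
      using pos \<open>i \<in> I\<close> \<open>j \<in> I\<close> by (metis inj_onD linorder_neqE_nat)
    then show ?thesis
    proof cases
      case 1
      then have "less c d f f'' i" using that(1,5,6) unfolding less_def by auto
      then show ?thesis using that(1) by blast
    next
      case 2
      then have "less c d f f'' j" using that(2,5,6) unfolding less_def by auto
      then show ?thesis using that(2) by blast
    next
      case 3
      then have "less c d f' f'' i" using that(6) by simp
      then have "less c d f f'' i"
        using strict[OF that(1,3,4), of f f' f''] that(5) unfolding less_def by metis
      then show ?thesis using that(1) by blast
    qed
  qed
  have irrefl: "\<not> less c d f f i" for c d f i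
    by (simp add: less_def)
  have "linear_order_on (Hom L c d) (Q c d)" if cd: "c \<in> Obj L" "d \<in> Obj L" for c d
    unfolding linear_order_on_def partial_order_on_def preorder_on_def
  proof (intro conjI)
    show "Q c d \<subseteq> Hom L c d \<times> Hom L c d" "refl_on (Hom L c d) (Q c d)"
      by (auto simp: refl_on_def Q_def)
    show "trans (Q c d)"
      by (rule transI) (use less_chain[OF _ _ cd] in \<open>fastforce simp: Q_def\<close>)
    show "antisym (Q c d)"
      by (rule antisymI) (use less_chain[OF _ _ cd] irrefl in \<open>fastforce simp: Q_def\<close>)
    show "total_on (Hom L c d) (Q c d)"
    proof (rule total_onI)
      fix f f' assume f: "f \<in> Hom L c d" "f' \<in> Hom L c d" "f \<noteq> f'"
      \<comment> \<open>Some leg separates the two arrows; the separating index of least position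
        decides their order.\<close>
      have "\<exists>i. i \<in> I \<and> AMap (F i) f \<noteq> AMap (F i) f'"
        using f joint_Arr[of f f'] by (auto simp: Hom_def)
      then obtain i where i: "i \<in> I" "AMap (F i) f \<noteq> AMap (F i) f'"
        and least: "\<And>j. j \<in> I \<Longrightarrow> pos j < pos i \<Longrightarrow> AMap (F j) f = AMap (F j) f'"
        using ex_has_least_nat[of "\<lambda>i. i \<in> I \<and> AMap (F i) f \<noteq> AMap (F i) f'" _ pos]
        by (metis not_less)
      interpret Fi: is_functor L "E i" "F i" using functors i by blast
      have "less c d f f' i \<or> less c d f' f i"
        using lin[OF i(1) Fi.OMap_Obj[OF cd(1)] Fi.OMap_Obj[OF cd(2)]] i(2) least
          Fi.AMap_Hom[OF f(1)] Fi.AMap_Hom[OF f(2)]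
        by (auto simp: linear_order_on_def total_on_def less_def)
      then show "(f, f') \<in> Q c d \<or> (f', f) \<in> Q c d"
        using f i(1) by (auto simp: Q_def)
    qed
  qed
  moreover have "(Comp L g f1, Comp L g f2) \<in> Q c e - Id"
    if obj: "c \<in> Obj L" "d \<in> Obj L" "e \<in> Obj L" and g: "g \<in> Hom L d e"
      and f: "f1 \<in> Hom L c d" "f2 \<in> Hom L c d" and lt: "(f1, f2) \<in> Q c d - Id" for c d e g f1 f2
  proof -
    obtain i where i: "i \<in> I" "less c d f1 f2 i" using lt by (auto simp: Q_def)
    interpret Fi: is_functor L "E i" "F i" using functors i by blast
    \<comment> \<open>The same index serves after composition: earlier coordinates stay equal, and
      at \<open>i\<close> composition with the image of \<open>g\<close> preserves strict
      inequality.\<close>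
    have "less c e (Comp L g f1) (Comp L g f2) i"
      unfolding less_def
    proof (intro conjI ballI impI)
      show "(AMap (F i) (Comp L g f1), AMap (F i) (Comp L g f2)) \<in> R i (OMap (F i) c) (OMap (F i) e) - Id"
        unfolding Fi.AMap_Comp[OF f(1) g] Fi.AMap_Comp[OF f(2) g]
        by (rule pres[OF i(1)]) (use i obj g f in \<open>auto simp: less_def Fi.OMap_Obj Fi.AMap_Hom\<close>)
      fix j assume j: "j \<in> I" "pos j < pos i"
      then show "AMap (F j) (Comp L g f1) = AMap (F j) (Comp L g f2)"
        using i(2) is_functor.AMap_Comp[OF functors[OF j(1)] f(1) g]
          is_functor.AMap_Comp[OF functors[OF j(1)] f(2) g] by (simp add: less_def)
    qed
    then show ?thesis
      using i(1) irrefl Comp_Hom[OF f(1) g] Comp_Hom[OF f(2) g] by (auto simp: Q_def)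
  qed
  ultimately show ?thesis
    unfolding left_locally_totally_ordered_def using category_axioms by (intro conjI exI[of _ Q]) blast+
qed

end

section \<open>Concatenation of words\<close>

lemma Hom_Sub:
  "X \<in> Hom (Sub \<Sigma> w) u v \<longleftrightarrow>
     w \<in> lists \<Sigma> \<and> u \<in> lists \<Sigma> \<and> v \<in> lists \<Sigma> \<and> subword_inclusions u w \<noteq> {} \<and>
     subword_inclusions v w \<noteq> {} \<and> (\<exists>f \<in> subword_inclusions u v. X = (u, f, v))"
  by (auto simp: Hom_def Sub_def full_subcategory_def Word_def)

lemma Obj_Sub:
  "v \<in> Obj (Sub \<Sigma> w) \<longleftrightarrow> w \<in> lists \<Sigma> \<and> v \<in> lists \<Sigma> \<and> subword_inclusions v w \<noteq> {}"
  by (auto simp: Hom_def Sub_def full_subcategory_def Word_def)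

lemma Ident_Sub: "Ident (Sub \<Sigma> w) v = (v, restrict id {..<length v}, v)"
  by (simp add: Sub_def full_subcategory_def Word_def)

lemma Comp_Sub: "Comp (Sub \<Sigma> w) (v', g, x) (u, f, v) = (u, compose {..<length u} g f, x)"
  by (simp add: Sub_def full_subcategory_def Word_def)

text \<open>An injective \<open>h\<close> places disjoint copies of the two alphabets inside one
  letter type, so that the letters reveal which factor they come from.\<close>

definition append_word :: "('s + 't \<Rightarrow> 'r) \<Rightarrow> 's list \<Rightarrow> 't list \<Rightarrow> 'r list" where
  "append_word h v v' = map (h \<circ> Inl) v @ map (h \<circ> Inr) v'"

text \<open>The sources have lengths \<open>m\<close> and \<open>m'\<close>, and \<open>n\<close> is
  the length of the first target word, hence the offset of the second block. The restriction makes
  the map extensional, as \<open>subword_inclusions\<close> demands.\<close>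

definition append_map :: "nat \<Rightarrow> nat \<Rightarrow> nat \<Rightarrow> (nat \<Rightarrow> nat) \<Rightarrow> (nat \<Rightarrow> nat) \<Rightarrow> nat \<Rightarrow> nat" where
  "append_map m m' n f f' =
     (\<lambda>k\<in>{..<m + m'}. if k < m then f k else n + f' (k - m))"

definition append_arrow :: "('s + 't \<Rightarrow> 'r) \<Rightarrow> 's word_arrow \<Rightarrow> 't word_arrow \<Rightarrow> 'r word_arrow" where
  "append_arrow h = (\<lambda>(v, f, w) (v', f', w').
     (append_word h v v', append_map (length v) (length v') (length w) f f', append_word h w w'))"

lemma length_append_word [simp]: "length (append_word h v v') = length v + length v'"
  by (simp add: append_word_def)

text \<open>Filtering for letters that stem from the left summand recovers the first word, and
  filtering for the remaining letters recovers the second.\<close>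

lemma append_word_eq_iff:
  assumes "inj h"
  shows "append_word h v v' = append_word h w w' \<longleftrightarrow> v = w \<and> v' = w'"
proof
  let ?p = "\<lambda>x. x \<in> range (h \<circ> Inl)"
  have "filter ?p (append_word h u u') = map (h \<circ> Inl) u"
    and "filter (Not \<circ> ?p) (append_word h u u') = map (h \<circ> Inr) u'" for u u'
    using assms by (auto simp: append_word_def filter_id_conv filter_empty_conv inj_def)
  moreover assume "append_word h v v' = append_word h w w'"
  ultimately have "map (h \<circ> Inl) v = map (h \<circ> Inl) w" "map (h \<circ> Inr) v' = map (h \<circ> Inr) w'"
    by metis+
  moreover have "inj (h \<circ> Inl)" "inj (h \<circ> Inr)"
    using assms by (simp_all add: inj_compose)
  ultimately show "v = w \<and> v' = w'"
    by (simp add: inj_map_eq_map)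
qed simp

text \<open>On a linear order, injective and monotone together mean strictly increasing. In this
  form, claims about concatenations reduce to arithmetic on positions.\<close>

lemma subword_inclusions_iff:
  "f \<in> subword_inclusions v w \<longleftrightarrow>
     f \<in> extensional {..<length v} \<and> (\<forall>i < length v. f i < length w \<and> w ! f i = v ! i) \<and>
     (\<forall>i j. i < j \<longrightarrow> j < length v \<longrightarrow> f i < f j)"
  (is "?l \<longleftrightarrow> ?r")
proof
  assume l: ?l
  have "f i < f j" if "i < j" "j < length v" for i j
  proof -
    have "f i \<le> f j" "f i \<noteq> f j"
      using l that by (auto simp: subword_inclusions_def monotone_on_def inj_on_def)
    then show ?thesis by simp
  qed
  with l show ?r by (auto simp: subword_inclusions_def PiE_def Pi_def)
next
  assume r: ?r
  then have "inj_on f {..<length v}"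
    by (intro linorder_inj_onI) force+
  moreover from r have "mono_on {..<length v} f"
    by (auto simp: monotone_on_def order.order_iff_strict)
  ultimately show ?l
    using r by (auto simp: subword_inclusions_def PiE_def Pi_def)
qed

text \<open>Each block is sent into the corresponding block, and the first target block lies wholly
  before the second; strict increase inside the blocks therefore suffices.\<close>

lemma append_map_subword_inclusion:
  assumes "f \<in> subword_inclusions v w" and "f' \<in> subword_inclusions v' w'"
  shows "append_map (length v) (length v') (length w) f f'
    \<in> subword_inclusions (append_word h v v') (append_word h w w')"
  using assms unfolding subword_inclusions_iff
  by (auto simp: append_map_def append_word_def nth_append trans_less_add1 less_diff_conv2)

lemma append_map_Ident:
  "append_map m m' m (restrict id {..<m}) (restrict id {..<m'}) = restrict id {..<m + m'}"
  by (auto simp: append_map_def fun_eq_iff)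

text \<open>The bound on \<open>f\<close> keeps the first block below \<open>n\<close>, while the
  offset keeps the second block at or above \<open>n\<close>; hence the outer case distinction makes
  the same choice as the inner one.\<close>

lemma append_map_compose:
  assumes "f \<in> {..<m} \<rightarrow> {..<n}" and "f' \<in> {..<m'} \<rightarrow> {..<n'}"
  shows "append_map m m' k (compose {..<m} g f) (compose {..<m'} g' f') =
    compose {..<m + m'} (append_map n n' k g g') (append_map m m' n f f')"
proof
  fix i
  have "f' (i - m) < n'" if "\<not> i < m" "i < m + m'"
    using assms(2) that by (auto simp: Pi_def)
  moreover have "f i < n" if "i < m"
    using assms(1) that by auto
  ultimately show "append_map m m' k (compose {..<m} g f) (compose {..<m'} g' f') i =
    compose {..<m + m'} (append_map n n' k g g') (append_map m m' n f f') i"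
    by (auto simp: append_map_def compose_def)
qed

lemma append_map_eqD:
  assumes "append_map m m' n f f' = append_map m m' n g g'"
    and "f \<in> extensional {..<m}" "g \<in> extensional {..<m}"
    and "f' \<in> extensional {..<m'}" "g' \<in> extensional {..<m'}"
  shows "f = g" and "f' = g'"
proof -
  show "f = g"
  proof (rule extensionalityI[OF assms(2,3)])
    show "f i = g i" if "i \<in> {..<m}" for i
      using fun_cong[OF assms(1), of i] that by (simp add: append_map_def)
  qed
  show "f' = g'"
  proof (rule extensionalityI[OF assms(4,5)])
    \<comment> \<open>Position \<open>m + i\<close> lies in the second block; cancelling the offset
      \<open>n\<close> leaves the values at \<open>i\<close>.\<close>
    show "f' i = g' i" if "i \<in> {..<m'}" for i
      using fun_cong[OF assms(1), of "m + i"] that by (simp add: append_map_def)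
  qed
qed

text \<open>Concatenating inclusions into \<open>w\<close> and \<open>w'\<close> yields one into the
  concatenation. Taking the whole letter type as the alphabet makes membership of letters
  automatic.\<close>

lemma append_word_Sub:
  assumes "u \<in> Obj (Sub \<Sigma> w)" and "u' \<in> Obj (Sub \<Sigma>' w')"
  shows "append_word h u u' \<in> Obj (Sub UNIV (append_word h w w'))"
proof -
  obtain f f' where "f \<in> subword_inclusions u w" "f' \<in> subword_inclusions u' w'"
    using assms unfolding Obj_Sub by blast
  from append_map_subword_inclusion[OF this] show ?thesis
    unfolding Obj_Sub by auto
qed

lemma append_arrow_Sub:
  assumes X: "X \<in> Hom (Sub \<Sigma> w) u v" and X': "X' \<in> Hom (Sub \<Sigma>' w') u' v'"
  shows "append_arrow h X X' \<in> Hom (Sub UNIV (append_word h w w')) (append_word h u u') (append_word h v v')"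
proof -
  obtain f f' where f: "X = (u, f, v)" "f \<in> subword_inclusions u v"
    and f': "X' = (u', f', v')" "f' \<in> subword_inclusions u' v'"
    using X X' unfolding Hom_Sub by blast
  have "append_word h u u' \<in> Obj (Sub UNIV (append_word h w w'))"
    "append_word h v v' \<in> Obj (Sub UNIV (append_word h w w'))"
    using append_word_Sub[OF Hom_Dom_Cod(4)[OF category_Sub X] Hom_Dom_Cod(4)[OF category_Sub X']]
      append_word_Sub[OF Hom_Dom_Cod(5)[OF category_Sub X] Hom_Dom_Cod(5)[OF category_Sub X']]
    by blast+
  then show ?thesis
    using append_map_subword_inclusion[OF f(2) f'(2)]
    unfolding Hom_Sub Obj_Sub by (simp add: append_arrow_def f(1) f'(1))
qed

section \<open>Combining word-valued functors\<close>

text \<open>This replaces the pairing of \<open>F\<close> and \<open>G\<close> into a product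
  category: a single word-valued functor that remembers both when \<open>h\<close> is
  injective.\<close>

definition append_functor ::
  "('s + 't \<Rightarrow> 'r) \<Rightarrow> ('o, 'a, 's list, 's word_arrow) functor_maps
     \<Rightarrow> ('o, 'a, 't list, 't word_arrow) functor_maps
     \<Rightarrow> ('o, 'a, 'r list, 'r word_arrow) functor_maps" where
  "append_functor h F G =
     \<lparr>OMap = (\<lambda>c. append_word h (OMap F c) (OMap G c)),
      AMap = (\<lambda>f. append_arrow h (AMap F f) (AMap G f))\<rparr>"

lemma is_functor_append_functor:
  assumes F: "is_functor L (Sub \<Sigma> w) F" and G: "is_functor L (Sub \<Sigma>' w') G"
  shows "is_functor L (Sub UNIV (append_word h w w')) (append_functor h F G)"
proof -
  interpret F: is_functor L "Sub \<Sigma> w" F by fact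
  interpret G: is_functor L "Sub \<Sigma>' w'" G by fact
  interpret T: category "Sub UNIV (append_word h w w')" by (rule category_Sub)
  show ?thesis
  proof
    show "OMap (append_functor h F G) c \<in> Obj (Sub UNIV (append_word h w w'))" if "c \<in> Obj L" for c
      using append_word_Sub[OF F.OMap_Obj[OF that] G.OMap_Obj[OF that]]
      by (simp add: append_functor_def)
  next
    fix f c d assume f: "f \<in> Hom L c d"
    show "AMap (append_functor h F G) f \<in> Hom (Sub UNIV (append_word h w w'))
        (OMap (append_functor h F G) c) (OMap (append_functor h F G) d)"
      using append_arrow_Sub[OF F.AMap_Hom[OF f] G.AMap_Hom[OF f]]
      by (simp add: append_functor_def)
  next
    fix c assume "c \<in> Obj L"
    then show "AMap (append_functor h F G) (Ident L c) =
        Ident (Sub UNIV (append_word h w w')) (OMap (append_functor h F G) c)"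
      by (simp add: append_functor_def append_arrow_def F.AMap_Ident G.AMap_Ident Ident_Sub
          append_map_Ident)
  next
    fix f g c d e assume f: "f \<in> Hom L c d" and g: "g \<in> Hom L d e"
    obtain p q where p: "AMap F f = (OMap F c, p, OMap F d)" "p \<in> subword_inclusions (OMap F c) (OMap F d)"
      and q: "AMap F g = (OMap F d, q, OMap F e)"
      using F.AMap_Hom[OF f] F.AMap_Hom[OF g] unfolding Hom_Sub by blast
    obtain p' q' where p': "AMap G f = (OMap G c, p', OMap G d)" "p' \<in> subword_inclusions (OMap G c) (OMap G d)"
      and q': "AMap G g = (OMap G d, q', OMap G e)"
      using G.AMap_Hom[OF f] G.AMap_Hom[OF g] unfolding Hom_Sub by blast
    have "p \<in> {..<length (OMap F c)} \<rightarrow> {..<length (OMap F d)}"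
      "p' \<in> {..<length (OMap G c)} \<rightarrow> {..<length (OMap G d)}"
      using p(2) p'(2) by (auto simp: subword_inclusions_def)
    then show "AMap (append_functor h F G) (Comp L g f) = Comp (Sub UNIV (append_word h w w'))
        (AMap (append_functor h F G) g) (AMap (append_functor h F G) f)"
      by (simp add: append_functor_def append_arrow_def F.AMap_Comp[OF f g] G.AMap_Comp[OF f g]
          p(1) q p'(1) q' Comp_Sub append_map_compose)
  qed
qed

text \<open>Images of parallel arrows share their source and target words, so only the position maps
  are compared, and these split blockwise by \<open>append_map_eqD\<close>.\<close>

lemma AMap_append_functor_eqD:
  assumes F: "is_functor L (Sub \<Sigma> w) F" and G: "is_functor L (Sub \<Sigma>' w') G"
    and f: "f \<in> Hom L c d" "g \<in> Hom L c d"
    and eq: "AMap (append_functor h F G) f = AMap (append_functor h F G) g"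
  shows "AMap F f = AMap F g" and "AMap G f = AMap G g"
proof -
  interpret F: is_functor L "Sub \<Sigma> w" F by fact
  interpret G: is_functor L "Sub \<Sigma>' w'" G by fact
  obtain p q where p: "AMap F f = (OMap F c, p, OMap F d)" "p \<in> subword_inclusions (OMap F c) (OMap F d)"
    and q: "AMap F g = (OMap F c, q, OMap F d)" "q \<in> subword_inclusions (OMap F c) (OMap F d)"
    using F.AMap_Hom[OF f(1)] F.AMap_Hom[OF f(2)] unfolding Hom_Sub by blast
  obtain p' q' where p': "AMap G f = (OMap G c, p', OMap G d)" "p' \<in> subword_inclusions (OMap G c) (OMap G d)"
    and q': "AMap G g = (OMap G c, q', OMap G d)" "q' \<in> subword_inclusions (OMap G c) (OMap G d)"
    using G.AMap_Hom[OF f(1)] G.AMap_Hom[OF f(2)] unfolding Hom_Sub by blast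
  have "append_map (length (OMap F c)) (length (OMap G c)) (length (OMap F d)) p p' =
    append_map (length (OMap F c)) (length (OMap G c)) (length (OMap F d)) q q'"
    using eq by (simp add: append_functor_def append_arrow_def p(1) q(1) p'(1) q'(1))
  from append_map_eqD[OF this] p(2) q(2) p'(2) q'(2)
  have "p = q" "p' = q'"
    by (simp_all add: subword_inclusions_iff)
  then show "AMap F f = AMap F g" "AMap G f = AMap G g"
    by (simp_all add: p(1) q(1) p'(1) q'(1))
qed

text \<open>Cardinal arithmetic: an infinite set is equipotent to its sum with itself. Concatenation
  can thus be iterated over one and the same letter type.\<close>

lemma infinite_inj_sum:
  assumes "infinite (UNIV :: 's set)"
  obtains h :: "'s + 's \<Rightarrow> 's" where "inj h"
proof -
  from card_of_ordIso[THEN iffD2, OF card_of_Plus_infinite1[OF assms ordIso_imp_ordLeq[OF card_of_refl]]]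
  obtain h :: "'s + 's \<Rightarrow> 's" where "bij_betw h (UNIV <+> UNIV) UNIV" by blast
  then have "inj h" by (simp add: bij_betw_def)
  then show thesis by (rule that)
qed

text \<open>Induction on the index set, appending one functor at a time. The conclusion says that
  \<open>H\<close> loses nothing the functors \<open>F i\<close> record; on arrows this is stated
  within hom-sets, as faithfulness requires.\<close>

lemma finite_product_of_word_functors:
  fixes F :: "'i \<Rightarrow> ('o, 'a, 's list, 's word_arrow) functor_maps"
  assumes inf: "infinite (UNIV :: 's set)" and L: "category L" and "finite I"
    and F: "\<And>i. i \<in> I \<Longrightarrow> is_functor L (Sub (\<Sigma> i) (w i)) (F i)"
  shows "\<exists>(v :: 's list) H. is_functor L (Sub UNIV v) H \<and>
    (\<forall>c d. OMap H c = OMap H d \<longrightarrow> (\<forall>i\<in>I. OMap (F i) c = OMap (F i) d)) \<and>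
    (\<forall>c d. \<forall>f\<in>Hom L c d. \<forall>g\<in>Hom L c d. AMap H f = AMap H g \<longrightarrow> (\<forall>i\<in>I. AMap (F i) f = AMap (F i) g))"
  using \<open>finite I\<close> F
proof (induction I)
  case empty
  interpret category L by fact
  interpret T: category "Sub (UNIV :: 's set) []" by (rule category_Sub)
  \<comment> \<open>With no functor to record, the constant functor at the empty word
    serves.\<close>
  have "is_functor L (Sub UNIV []) \<lparr>OMap = \<lambda>_. [], AMap = \<lambda>_. Ident (Sub (UNIV :: 's set) []) []\<rparr>"
    by unfold_locales (auto simp: Hom_Sub Obj_Sub Ident_Sub Comp_Sub subword_inclusions_iff compose_def)
  then show ?case by auto
next
  case (insert i I)
  have "is_functor L (Sub (\<Sigma> j) (w j)) (F j)" if "j \<in> I" for j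
    using insert.prems that by blast
  from insert.IH[OF this]
  obtain v :: "'s list" and H where H: "is_functor L (Sub UNIV v) H"
    and O: "\<forall>c d. OMap H c = OMap H d \<longrightarrow> (\<forall>j\<in>I. OMap (F j) c = OMap (F j) d)"
    and A: "\<forall>c d. \<forall>f\<in>Hom L c d. \<forall>g\<in>Hom L c d. AMap H f = AMap H g \<longrightarrow>
      (\<forall>j\<in>I. AMap (F j) f = AMap (F j) g)"
    by blast
  obtain h :: "'s + 's \<Rightarrow> 's" where h: "inj h" using infinite_inj_sum[OF inf] .
  have Fi: "is_functor L (Sub (\<Sigma> i) (w i)) (F i)" using insert by simp
  let ?G = "append_functor h (F i) H"
  have obj: "OMap (F j) c = OMap (F j) d" if "OMap ?G c = OMap ?G d" "j \<in> insert i I" for c d j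
  proof -
    have "OMap (F i) c = OMap (F i) d" "OMap H c = OMap H d"
      using that(1) by (simp_all add: append_functor_def append_word_eq_iff[OF h])
    then show ?thesis using O that(2) by blast
  qed
  have arr: "AMap (F j) f = AMap (F j) g"
    if "f \<in> Hom L c d" "g \<in> Hom L c d" "AMap ?G f = AMap ?G g" "j \<in> insert i I" for c d f g j
  proof (cases "j = i")
    case True
    then show ?thesis using AMap_append_functor_eqD(1)[OF Fi H that(1-3)] by simp
  next
    case False
    then show ?thesis
      using A[rule_format, OF that(1,2) AMap_append_functor_eqD(2)[OF Fi H that(1-3)]] that(4) by simp
  qed
  show ?case
    apply (intro exI[of _ "append_word h (w i) v"] exI[of _ ?G] conjI)
    subgoal by (rule is_functor_append_functor[OF Fi H])
    subgoal by (intro allI impI ballI) (rule obj)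
    subgoal by (intro allI impI ballI) (rule arr)
    done
qed

section \<open>Word embeddings of jointly faithful sources\<close>

lemma is_functor_compose:
  assumes "is_functor C D F" and "is_functor D E G"
  shows "is_functor C E \<lparr>OMap = OMap G \<circ> OMap F, AMap = AMap G \<circ> AMap F\<rparr>"
proof -
  interpret F: is_functor C D F by fact
  interpret G: is_functor D E G by fact
  show ?thesis
  proof
    fix f g c d e assume f: "f \<in> Hom C c d" and g: "g \<in> Hom C d e"
    show "AMap \<lparr>OMap = OMap G \<circ> OMap F, AMap = AMap G \<circ> AMap F\<rparr> (Comp C g f) =
      Comp E (AMap \<lparr>OMap = OMap G \<circ> OMap F, AMap = AMap G \<circ> AMap F\<rparr> g)
        (AMap \<lparr>OMap = OMap G \<circ> OMap F, AMap = AMap G \<circ> AMap F\<rparr> f)"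
      using G.AMap_Comp[OF F.AMap_Hom[OF f] F.AMap_Hom[OF g]] by (simp add: F.AMap_Comp[OF f g])
  qed (simp_all add: F.OMap_Obj G.OMap_Obj F.AMap_Hom G.AMap_Hom F.AMap_Ident G.AMap_Ident)
qed

text \<open>Each leg is followed by a word embedding of its target, and the composites are merged
  into one functor \<open>H\<close>. Equal values of \<open>H\<close> give equal values of every
  composite, hence of every leg, and the legs separate.\<close>

lemma (in jointly_faithful) weakly_word_embeddable_source:
  assumes inf: "infinite (UNIV :: 's set)"
    and emb: "\<And>i. i \<in> I \<Longrightarrow> weakly_word_embeddable TYPE('s) (E i)"
  shows "weakly_word_embeddable TYPE('s) L"
proof -
  have "\<exists>\<Sigma> w W. \<forall>i\<in>I. is_functor (E i) (Sub (\<Sigma> i :: 's set) (w i)) (W i) \<and>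
      faithful (E i) (W i) \<and> inj_on (OMap (W i)) (Obj (E i))"
    using emb unfolding weakly_word_embeddable_def by metis
  then obtain \<Sigma> :: "'i \<Rightarrow> 's set" and w W where
    W: "\<And>i. i \<in> I \<Longrightarrow> is_functor (E i) (Sub (\<Sigma> i) (w i)) (W i)"
    and faith: "\<And>i. i \<in> I \<Longrightarrow> faithful (E i) (W i)"
    and inj: "\<And>i. i \<in> I \<Longrightarrow> inj_on (OMap (W i)) (Obj (E i))"
    by metis
  define G where "G i = \<lparr>OMap = OMap (W i) \<circ> OMap (F i), AMap = AMap (W i) \<circ> AMap (F i)\<rparr>" for i
  have "is_functor L (Sub (\<Sigma> i) (w i)) (G i)" if "i \<in> I" for i
    unfolding G_def using is_functor_compose[OF functors W] that by blast
  from finite_product_of_word_functors[where I = I and F = G, OF inf category_axioms finite_index this]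
  obtain v :: "'s list" and H where H: "is_functor L (Sub UNIV v) H"
    and O: "\<forall>c d. OMap H c = OMap H d \<longrightarrow> (\<forall>i\<in>I. OMap (G i) c = OMap (G i) d)"
    and A: "\<forall>c d. \<forall>f\<in>Hom L c d. \<forall>g\<in>Hom L c d. AMap H f = AMap H g \<longrightarrow>
      (\<forall>i\<in>I. AMap (G i) f = AMap (G i) g)"
    by blast
  have "inj_on (OMap H) (Obj L)"
  proof (intro inj_onI joint_Obj)
    fix c d i assume cd: "c \<in> Obj L" "d \<in> Obj L" "OMap H c = OMap H d" and i: "i \<in> I"
    interpret Fi: is_functor L "E i" "F i" using functors i by blast
    have "OMap (G i) c = OMap (G i) d" using O cd(3) i by blast
    then show "OMap (F i) c = OMap (F i) d"
      using inj_onD[OF inj[OF i]] Fi.OMap_Obj cd(1,2) by (simp add: G_def)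
  qed
  moreover have "faithful L H"
    unfolding faithful_def
  proof (intro ballI inj_onI joint_Arr)
    fix c d f g i assume cd: "c \<in> Obj L" "d \<in> Obj L"
      and fg: "f \<in> Hom L c d" "g \<in> Hom L c d" "AMap H f = AMap H g" and i: "i \<in> I"
    interpret Fi: is_functor L "E i" "F i" using functors i by blast
    \<comment> \<open>Faithfulness is injectivity on single hom-sets; it applies because the images
      of the parallel arrows \<open>f\<close> and \<open>g\<close> are parallel.\<close>
    have "inj_on (AMap (W i)) (Hom (E i) (OMap (F i) c) (OMap (F i) d))"
      using faith[OF i] Fi.OMap_Obj cd by (simp add: faithful_def)
    moreover have "AMap (G i) f = AMap (G i) g" using A fg i by blast
    ultimately show "AMap (F i) f = AMap (F i) g"
      using inj_onD[OF _ _ Fi.AMap_Hom[OF fg(1)] Fi.AMap_Hom[OF fg(2)]] by (simp add: G_def)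
  qed (auto simp: Hom_def)
  ultimately show ?thesis
    unfolding weakly_word_embeddable_def using H by (intro exI[of _ UNIV] exI[of _ v] exI[of _ H]) simp
qed

section \<open>Limits of small categories\<close>

abbreviation functor_of :: "('o, 'a) functor_arrow \<Rightarrow> ('o, 'a, 'o, 'a) functor_maps" where
  "functor_of X \<equiv> fst (snd X)"

lemma Hom_small_Cat:
  "X \<in> Hom small_Cat C D \<longleftrightarrow>
     X = (C, functor_of X, D) \<and> is_functor C D (functor_of X) \<and>
     OMap (functor_of X) \<in> extensional (Obj C) \<and> AMap (functor_of X) \<in> extensional (Arr C)"
  by (cases X) (auto simp: Hom_def small_Cat_def)

lemma Obj_small_Cat [simp]: "C \<in> Obj small_Cat \<longleftrightarrow> category C"
  by (simp add: small_Cat_def)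

lemma functor_maps_eqI:
  fixes F G :: "('o1, 'a1, 'o2, 'a2) functor_maps"
  shows "OMap F = OMap G \<Longrightarrow> AMap F = AMap G \<Longrightarrow> F = G"
  by (cases F, cases G) simp

text \<open>Extensionality fixes the maps outside \<open>C\<close>, so agreement inside
  \<open>C\<close> is enough.\<close>

lemma small_Cat_arrow_eqI:
  assumes X: "X \<in> Hom small_Cat C D" and Y: "Y \<in> Hom small_Cat C D"
    and "\<And>c. c \<in> Obj C \<Longrightarrow> OMap (functor_of X) c = OMap (functor_of Y) c"
    and "\<And>f. f \<in> Arr C \<Longrightarrow> AMap (functor_of X) f = AMap (functor_of Y) f"
  shows "X = Y"
proof -
  have "functor_of X = functor_of Y"
    using assms unfolding Hom_small_Cat by (intro functor_maps_eqI) (auto intro: extensionalityI)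
  moreover have "X = (C, functor_of X, D)" "Y = (C, functor_of Y, D)"
    using X Y unfolding Hom_small_Cat by blast+
  ultimately show ?thesis by metis
qed

lemma functor_of_Comp:
  assumes "X \<in> Hom small_Cat C D" and "Y \<in> Hom small_Cat D E"
  shows "c \<in> Obj C \<Longrightarrow> OMap (functor_of (Comp small_Cat Y X)) c = OMap (functor_of Y) (OMap (functor_of X) c)"
    and "f \<in> Arr C \<Longrightarrow> AMap (functor_of (Comp small_Cat Y X)) f = AMap (functor_of Y) (AMap (functor_of X) f)"
  using assms by (auto simp: Hom_def small_Cat_def comp_functor_def compose_def)

lemma Comp_small_Cat_eqI:
  assumes X: "X \<in> Hom small_Cat C D" and Y: "Y \<in> Hom small_Cat D E" and Z: "Z \<in> Hom small_Cat C E"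
    and "\<And>c. c \<in> Obj C \<Longrightarrow> OMap (functor_of Y) (OMap (functor_of X) c) = OMap (functor_of Z) c"
    and "\<And>f. f \<in> Arr C \<Longrightarrow> AMap (functor_of Y) (AMap (functor_of X) f) = AMap (functor_of Z) f"
  shows "Comp small_Cat Y X = Z"
  by (rule small_Cat_arrow_eqI[OF category.Comp_Hom[OF category_small_Cat X Y] Z])
    (simp_all add: functor_of_Comp[OF X Y] assms(4,5))

section \<open>Separation of arrows by limit cones\<close>

text \<open>Both arrows mediate the cone obtained by composing the legs with \<open>h\<close>, and
  mediating arrows are unique.\<close>

lemma is_limit_jointly_monic:
  assumes D: "is_functor J K D" and lim: "is_limit J K D L \<pi>"
    and h: "h \<in> Hom K X L" "h' \<in> Hom K X L"
    and eq: "\<And>i. i \<in> Obj J \<Longrightarrow> Comp K (\<pi> i) h = Comp K (\<pi> i) h'"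
  shows "h = h'"
proof -
  interpret D: is_functor J K D by fact
  have leg: "\<pi> i \<in> Hom K L (OMap D i)" if "i \<in> Obj J" for i
    using lim that by (simp add: is_limit_def is_cone_def)
  have nat: "Comp K (AMap D u) (\<pi> (Dom J u)) = \<pi> (Cod J u)" if "u \<in> Arr J" for u
    using lim that by (simp add: is_limit_def is_cone_def)
  have "is_cone J K D X (\<lambda>i. Comp K (\<pi> i) h)"
    unfolding is_cone_def
  proof (intro conjI ballI)
    show "X \<in> Obj K" using Hom_Dom_Cod(4)[OF D.target.category_axioms h(1)] .
    show "Comp K (\<pi> i) h \<in> Hom K X (OMap D i)" if "i \<in> Obj J" for i
      using D.target.Comp_Hom[OF h(1) leg[OF that]] .
    fix u assume u: "u \<in> Arr J"
    show "Comp K (AMap D u) (Comp K (\<pi> (Dom J u)) h) = Comp K (\<pi> (Cod J u)) h"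
      using D.target.Comp_assoc[OF h(1) leg D.AMap_Hom[OF Arr_Hom[OF u]]] D.source.Dom_Obj[OF u]
        nat[OF u] by simp
  qed
  then have "\<exists>!k. k \<in> Hom K X L \<and> (\<forall>i\<in>Obj J. Comp K (\<pi> i) k = Comp K (\<pi> i) h)"
    using lim unfolding is_limit_def by blast
  then show ?thesis
    using h eq by (metis (no_types, lifting))
qed

text \<open>The category with one non-identity arrow \<open>a\<close> from \<open>x\<close> to
  \<open>y\<close>, where \<open>i\<close> and \<open>j\<close> are the identities. Its elements are
  parameters because they must come from the universe types. In a composable pair with
  \<open>f\<close> different from \<open>i\<close>, the arrow \<open>g\<close> is \<open>j\<close>,
  so the composite is \<open>f\<close>.\<close>

definition walking_arrow :: "'o \<Rightarrow> 'o \<Rightarrow> 'a \<Rightarrow> 'a \<Rightarrow> 'a \<Rightarrow> ('o, 'a) category" where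
  "walking_arrow x y i j a =
     \<lparr>Obj = {x, y}, Arr = {i, j, a}, Dom = (\<lambda>f. if f = j then y else x),
      Cod = (\<lambda>f. if f = i then x else y), Ident = (\<lambda>c. if c = x then i else j),
      Comp = (\<lambda>g f. if f = i then g else f)\<rparr>"

text \<open>Functors out of the walking arrow correspond to arrows of the target; this one picks out
  \<open>f\<close>.\<close>

definition arrow_functor ::
  "'o \<Rightarrow> 'o \<Rightarrow> 'a \<Rightarrow> 'a \<Rightarrow> 'a \<Rightarrow> ('o, 'a) category \<Rightarrow> 'a \<Rightarrow> ('o, 'a) functor_arrow" where
  "arrow_functor x y i j a C f =
     (walking_arrow x y i j a,
      \<lparr>OMap = (\<lambda>c\<in>{x, y}. if c = x then Dom C f else Cod C f),
       AMap = (\<lambda>g\<in>{i, j, a}. if g = i then Ident C (Dom C f) else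
                 if g = j then Ident C (Cod C f) else f)\<rparr>,
      C)"

lemma category_walking_arrow:
  assumes "x \<noteq> y" "i \<noteq> j" "i \<noteq> a" "j \<noteq> a"
  shows "category (walking_arrow x y i j a)"
  using assms by unfold_locales (auto simp: walking_arrow_def Hom_def split: if_splits)

lemma arrow_functor_Hom:
  assumes dist: "x \<noteq> y" "i \<noteq> j" "i \<noteq> a" "j \<noteq> a" and "category C" and f: "f \<in> Arr C"
  shows "arrow_functor x y i j a C f \<in> Hom small_Cat (walking_arrow x y i j a) C"
proof -
  interpret C: category C by fact
  interpret W: category "walking_arrow x y i j a" by (rule category_walking_arrow[OF dist])
  have H: "Ident C (Dom C f) \<in> Hom C (Dom C f) (Dom C f)" "Ident C (Cod C f) \<in> Hom C (Cod C f) (Cod C f)"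
    "f \<in> Hom C (Dom C f) (Cod C f)"
    using f C.Ident_Hom C.Dom_Obj C.Cod_Obj Arr_Hom by auto
  note comp = C.Comp_Ident_left[OF H(1)] C.Comp_Ident_left[OF H(2)] C.Comp_Ident_left[OF H(3)]
    C.Comp_Ident_right[OF H(3)]
  have "is_functor (walking_arrow x y i j a) C (functor_of (arrow_functor x y i j a C f))"
    using dist H comp C.Dom_Obj[OF f] C.Cod_Obj[OF f]
    by unfold_locales
      (auto simp: arrow_functor_def walking_arrow_def Hom_def split: if_splits)
  then show ?thesis
    unfolding Hom_small_Cat by (simp add: arrow_functor_def walking_arrow_def)
qed

text \<open>Testing the limit against the walking arrow shows that its legs separate arrows.\<close>

lemma is_limit_small_Cat_jointly_faithful:
  fixes D :: "('j, 'k, ('o, 'a) category, ('o, 'a) functor_arrow) functor_maps"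
  assumes infO: "infinite (UNIV :: 'o set)" and infA: "infinite (UNIV :: 'a set)"
    and "finite (Obj J)" and D: "is_functor J small_Cat D" and lim: "is_limit J small_Cat D L \<pi>"
  shows "jointly_faithful L (Obj J) (OMap D) (\<lambda>i. functor_of (\<pi> i))"
proof -
  have L: "category L" and leg: "\<And>i. i \<in> Obj J \<Longrightarrow> \<pi> i \<in> Hom small_Cat L (OMap D i)"
    using lim by (simp_all add: is_limit_def is_cone_def)
  have legs: "is_functor L (OMap D i) (functor_of (\<pi> i))" if "i \<in> Obj J" for i
    using leg[OF that] unfolding Hom_small_Cat by blast
  \<comment> \<open>Infinite universe types supply the two objects and three arrows of a walking
    arrow.\<close>
  obtain x y :: 'o where xy: "x \<noteq> y"
    using infO by (metis finite.simps ex_new_if_finite insertCI)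
  obtain i j a :: 'a where ija: "i \<noteq> j" "i \<noteq> a" "j \<noteq> a"
  proof -
    obtain i :: 'a where True by blast
    obtain j where "j \<notin> {i}" using ex_new_if_finite[OF infA, of "{i}"] by auto
    moreover obtain a where "a \<notin> {i, j}" using ex_new_if_finite[OF infA, of "{i, j}"] by auto
    ultimately show ?thesis using that[of i j a] by auto
  qed
  let ?A = "arrow_functor x y i j a L"
  show ?thesis
  proof (intro jointly_faithful.intro jointly_faithful_axioms.intro L legs \<open>finite (Obj J)\<close>)
    fix f g assume f: "f \<in> Arr L" and g: "g \<in> Arr L"
      and eq: "\<And>k. k \<in> Obj J \<Longrightarrow> AMap (functor_of (\<pi> k)) f = AMap (functor_of (\<pi> k)) g"
    note Af = arrow_functor_Hom[OF xy ija L f] and Ag = arrow_functor_Hom[OF xy ija L g]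
    have "?A f = ?A g"
    proof (rule is_limit_jointly_monic[OF D lim Af Ag])
      fix k assume k: "k \<in> Obj J"
      interpret P: is_functor L "OMap D k" "functor_of (\<pi> k)" by (rule legs[OF k])
      note ends = P.AMap_Arr(2)[OF f] P.AMap_Arr(2)[OF g] P.AMap_Arr(3)[OF f] P.AMap_Arr(3)[OF g]
      \<comment> \<open>Equal images of \<open>f\<close> and \<open>g\<close> have equal endpoints,
        so the two test functors agree on objects and identities after each leg, even if
        \<open>f\<close> and \<open>g\<close> are not known to be parallel.\<close>
      have O: "OMap (functor_of (\<pi> k)) (Dom L f) = OMap (functor_of (\<pi> k)) (Dom L g)"
        "OMap (functor_of (\<pi> k)) (Cod L f) = OMap (functor_of (\<pi> k)) (Cod L g)"
        using ends eq[OF k] by simp_all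
      show "Comp small_Cat (\<pi> k) (?A f) = Comp small_Cat (\<pi> k) (?A g)"
      proof (rule small_Cat_arrow_eqI)
        let ?W = "walking_arrow x y i j a"
        show "Comp small_Cat (\<pi> k) (?A f) \<in> Hom small_Cat ?W (OMap D k)"
          "Comp small_Cat (\<pi> k) (?A g) \<in> Hom small_Cat ?W (OMap D k)"
          using category.Comp_Hom[OF category_small_Cat _ leg[OF k]] Af Ag by blast+
        show "OMap (functor_of (Comp small_Cat (\<pi> k) (?A f))) c =
          OMap (functor_of (Comp small_Cat (\<pi> k) (?A g))) c" if c: "c \<in> Obj ?W" for c
          unfolding functor_of_Comp(1)[OF Af leg[OF k] c] functor_of_Comp(1)[OF Ag leg[OF k] c]
          by (simp add: arrow_functor_def restrict_def O)
        show "AMap (functor_of (Comp small_Cat (\<pi> k) (?A f))) m =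
          AMap (functor_of (Comp small_Cat (\<pi> k) (?A g))) m" if m: "m \<in> Arr ?W" for m
          unfolding functor_of_Comp(2)[OF Af leg[OF k] m] functor_of_Comp(2)[OF Ag leg[OF k] m]
          by (simp add: arrow_functor_def restrict_def O eq[OF k] P.AMap_Ident P.source.Dom_Obj
              P.source.Cod_Obj f g)
      qed
    qed
    \<comment> \<open>The value at the non-identity arrow \<open>a\<close> recovers the arrow picked
      out.\<close>
    then show "f = g"
      using ija by (auto simp: arrow_functor_def dest!: fun_cong[of _ _ a])
  qed
qed

section \<open>The explicit limit of categories\<close>

text \<open>The limit of a diagram of sets as a subset of the product. Leaving \<open>S\<close> and
  \<open>T\<close> general covers objects and arrows at once.\<close>

definition compatible_families :: "('j, 'k) category \<Rightarrow> ('j \<Rightarrow> 'x set) \<Rightarrow> ('k \<Rightarrow> 'x \<Rightarrow> 'x) \<Rightarrow> ('j \<Rightarrow> 'x) set" where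
  "compatible_families J S T =
     {x \<in> \<Pi>\<^sub>E i\<in>Obj J. S i. \<forall>u\<in>Arr J. T u (x (Dom J u)) = x (Cod J u)}"

lemma compatible_families_iff:
  "(\<lambda>i\<in>Obj J. x i) \<in> compatible_families J S T \<longleftrightarrow>
     (\<forall>i\<in>Obj J. x i \<in> S i) \<and> (\<forall>u\<in>Arr J. T u (x (Dom J u)) = x (Cod J u))"
  if "category J"
  using category.Dom_Obj[OF that] category.Cod_Obj[OF that] by (auto simp: compatible_families_def)

lemma compatible_familiesD:
  assumes "x \<in> compatible_families J S T"
  shows "i \<in> Obj J \<Longrightarrow> x i \<in> S i" and "u \<in> Arr J \<Longrightarrow> T u (x (Dom J u)) = x (Cod J u)"
  using assms by (auto simp: compatible_families_def)

lemma compatible_families_eqI: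
  assumes "x \<in> compatible_families J S T" "y \<in> compatible_families J S T"
    and "\<And>i. i \<in> Obj J \<Longrightarrow> x i = y i"
  shows "x = y"
  using assms unfolding compatible_families_def by (blast intro: PiE_ext)

lemma finite_compatible_families:
  assumes "finite (Obj J)" and "\<And>i. i \<in> Obj J \<Longrightarrow> finite (S i)"
  shows "finite (compatible_families J S T)"
  using finite_PiE[OF assms] by (rule finite_subset[rotated]) (auto simp: compatible_families_def)

text \<open>
  Families of objects and arrows do not live in the types \<open>'o\<close> and \<open>'a\<close>; the injections
  \<open>\<phi>\<close> and \<open>\<psi>\<close> encode them there.
\<close>

locale encoded_families =
  is_functor J small_Cat D
  for J :: "('j, 'k) category"
    and D :: "('j, 'k, ('o, 'a) category, ('o, 'a) functor_arrow) functor_maps" +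
  fixes \<phi> :: "('j \<Rightarrow> 'o) \<Rightarrow> 'o" and \<psi> :: "('j \<Rightarrow> 'a) \<Rightarrow> 'a"
  assumes inj_Obj: "inj_on \<phi> (compatible_families J (\<lambda>i. Obj (OMap D i)) (\<lambda>u. OMap (functor_of (AMap D u))))"
    and inj_Arr: "inj_on \<psi> (compatible_families J (\<lambda>i. Arr (OMap D i)) (\<lambda>u. AMap (functor_of (AMap D u))))"
begin

abbreviation "XO \<equiv> compatible_families J (\<lambda>i. Obj (OMap D i)) (\<lambda>u. OMap (functor_of (AMap D u)))"
abbreviation "XA \<equiv> compatible_families J (\<lambda>i. Arr (OMap D i)) (\<lambda>u. AMap (functor_of (AMap D u)))"
abbreviation "p \<equiv> inv_into XO \<phi>"
abbreviation "q \<equiv> inv_into XA \<psi>"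

text \<open>All structure is computed componentwise: \<open>p\<close> and \<open>q\<close> decode,
  the vertices operate, and \<open>\<phi>\<close> and \<open>\<psi>\<close> encode the
  result.\<close>

definition lim :: "('o, 'a) category" where
  "lim = \<lparr>Obj = \<phi> ` XO, Arr = \<psi> ` XA,
     Dom = (\<lambda>f. \<phi> (\<lambda>i\<in>Obj J. Dom (OMap D i) (q f i))),
     Cod = (\<lambda>f. \<phi> (\<lambda>i\<in>Obj J. Cod (OMap D i) (q f i))),
     Ident = (\<lambda>c. \<psi> (\<lambda>i\<in>Obj J. Ident (OMap D i) (p c i))),
     Comp = (\<lambda>g f. \<psi> (\<lambda>i\<in>Obj J. Comp (OMap D i) (q g i) (q f i)))\<rparr>"

definition proj :: "'j \<Rightarrow> ('o, 'a) functor_arrow" where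
  "proj i = (lim, \<lparr>OMap = (\<lambda>c\<in>Obj lim. p c i), AMap = (\<lambda>f\<in>Arr lim. q f i)\<rparr>, OMap D i)"

lemma category_vertex: "i \<in> Obj J \<Longrightarrow> category (OMap D i)"
  using OMap_Obj by simp

lemma edge_functor:
  "u \<in> Arr J \<Longrightarrow> is_functor (OMap D (Dom J u)) (OMap D (Cod J u)) (functor_of (AMap D u))"
  using AMap_Hom[OF Arr_Hom] unfolding Hom_small_Cat by blast

lemma p_\<phi>: "x \<in> XO \<Longrightarrow> p (\<phi> x) = x"
  using inj_Obj by (rule inv_into_f_f)

lemma q_\<psi>: "x \<in> XA \<Longrightarrow> q (\<psi> x) = x"
  using inj_Arr by (rule inv_into_f_f)

lemma p_Obj: "c \<in> Obj lim \<Longrightarrow> p c \<in> XO" "c \<in> Obj lim \<Longrightarrow> \<phi> (p c) = c"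
  by (simp_all add: lim_def inv_into_into f_inv_into_f)

lemma q_Arr: "f \<in> Arr lim \<Longrightarrow> q f \<in> XA" "f \<in> Arr lim \<Longrightarrow> \<psi> (q f) = f"
  by (simp_all add: lim_def inv_into_into f_inv_into_f)

lemma lim_Obj_eqI:
  assumes "c \<in> Obj lim" "d \<in> Obj lim" "\<And>i. i \<in> Obj J \<Longrightarrow> p c i = p d i"
  shows "c = d"
  using compatible_families_eqI[OF p_Obj(1)[OF assms(1)] p_Obj(1)[OF assms(2)] assms(3)] p_Obj(2) assms(1,2)
  by metis

lemma lim_Arr_eqI:
  assumes "f \<in> Arr lim" "g \<in> Arr lim" "\<And>i. i \<in> Obj J \<Longrightarrow> q f i = q g i"
  shows "f = g"
  using compatible_families_eqI[OF q_Arr(1)[OF assms(1)] q_Arr(1)[OF assms(2)] assms(3)] q_Arr(2) assms(1,2)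
  by metis

lemma \<phi>_lim: "x \<in> XO \<Longrightarrow> \<phi> x \<in> Obj lim"
  by (simp add: lim_def)

lemma \<psi>_lim: "x \<in> XA \<Longrightarrow> \<psi> x \<in> Arr lim"
  by (simp add: lim_def)

text \<open>Edges of the diagram are functors and so commute with the operations of a category. This
  lemma and the next three use that to keep the componentwise operations within compatible
  families.\<close>

lemma Dom_family: "f \<in> XA \<Longrightarrow> (\<lambda>i\<in>Obj J. Dom (OMap D i) (f i)) \<in> XO"
  unfolding compatible_families_iff[OF source.category_axioms]
proof (intro conjI ballI)
  assume f: "f \<in> XA"
  show "Dom (OMap D i) (f i) \<in> Obj (OMap D i)" if "i \<in> Obj J" for i
    using category.Dom_Obj[OF category_vertex[OF that]] compatible_familiesD(1)[OF f that] .
  fix u assume u: "u \<in> Arr J"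
  show "OMap (functor_of (AMap D u)) (Dom (OMap D (Dom J u)) (f (Dom J u))) =
    Dom (OMap D (Cod J u)) (f (Cod J u))"
    using is_functor.AMap_Arr(2)[OF edge_functor[OF u] compatible_familiesD(1)[OF f source.Dom_Obj[OF u]]]
      compatible_familiesD(2)[OF f u] by simp
qed

lemma Cod_family: "f \<in> XA \<Longrightarrow> (\<lambda>i\<in>Obj J. Cod (OMap D i) (f i)) \<in> XO"
  unfolding compatible_families_iff[OF source.category_axioms]
proof (intro conjI ballI)
  assume f: "f \<in> XA"
  show "Cod (OMap D i) (f i) \<in> Obj (OMap D i)" if "i \<in> Obj J" for i
    using category.Cod_Obj[OF category_vertex[OF that]] compatible_familiesD(1)[OF f that] .
  fix u assume u: "u \<in> Arr J"
  show "OMap (functor_of (AMap D u)) (Cod (OMap D (Dom J u)) (f (Dom J u))) =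
    Cod (OMap D (Cod J u)) (f (Cod J u))"
    using is_functor.AMap_Arr(3)[OF edge_functor[OF u] compatible_familiesD(1)[OF f source.Dom_Obj[OF u]]]
      compatible_familiesD(2)[OF f u] by simp
qed

lemma Ident_family: "x \<in> XO \<Longrightarrow> (\<lambda>i\<in>Obj J. Ident (OMap D i) (x i)) \<in> XA"
  unfolding compatible_families_iff[OF source.category_axioms]
proof (intro conjI ballI)
  assume x: "x \<in> XO"
  show "Ident (OMap D i) (x i) \<in> Arr (OMap D i)" if "i \<in> Obj J" for i
    using category.Ident_Hom[OF category_vertex[OF that] compatible_familiesD(1)[OF x that]]
    by (simp add: Hom_def)
  fix u assume u: "u \<in> Arr J"
  show "AMap (functor_of (AMap D u)) (Ident (OMap D (Dom J u)) (x (Dom J u))) =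
    Ident (OMap D (Cod J u)) (x (Cod J u))"
    using is_functor.AMap_Ident[OF edge_functor[OF u] compatible_familiesD(1)[OF x source.Dom_Obj[OF u]]]
      compatible_familiesD(2)[OF x u] by simp
qed

lemma Comp_family:
  assumes f: "f \<in> XA" and g: "g \<in> XA"
    and fg: "\<And>i. i \<in> Obj J \<Longrightarrow> f i \<in> Hom (OMap D i) (x i) (y i)"
      "\<And>i. i \<in> Obj J \<Longrightarrow> g i \<in> Hom (OMap D i) (y i) (z i)"
  shows "(\<lambda>i\<in>Obj J. Comp (OMap D i) (g i) (f i)) \<in> XA"
  unfolding compatible_families_iff[OF source.category_axioms]
proof (intro conjI ballI)
  show "Comp (OMap D i) (g i) (f i) \<in> Arr (OMap D i)" if "i \<in> Obj J" for i
    using category.Comp_Hom[OF category_vertex[OF that] fg(1)[OF that] fg(2)[OF that]]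
    by (simp add: Hom_def)
  fix u assume u: "u \<in> Arr J"
  show "AMap (functor_of (AMap D u)) (Comp (OMap D (Dom J u)) (g (Dom J u)) (f (Dom J u))) =
    Comp (OMap D (Cod J u)) (g (Cod J u)) (f (Cod J u))"
    using is_functor.AMap_Comp[OF edge_functor[OF u] fg(1)[OF source.Dom_Obj[OF u]] fg(2)[OF source.Dom_Obj[OF u]]]
      compatible_familiesD(2)[OF f u] compatible_familiesD(2)[OF g u] by simp
qed

text \<open>Encoded objects are equal when their components are, so endpoints can be checked at the
  vertices. Every law of \<open>lim\<close> is reduced to the vertices through this.\<close>

lemma Hom_lim:
  "f \<in> Hom lim c d \<longleftrightarrow> f \<in> Arr lim \<and> c \<in> Obj lim \<and> d \<in> Obj lim \<and>
     (\<forall>i\<in>Obj J. q f i \<in> Hom (OMap D i) (p c i) (p d i))"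
  (is "?l \<longleftrightarrow> ?r")
proof
  assume ?l
  then have f: "f \<in> Arr lim" and c: "c = \<phi> (\<lambda>i\<in>Obj J. Dom (OMap D i) (q f i))"
    and d: "d = \<phi> (\<lambda>i\<in>Obj J. Cod (OMap D i) (q f i))"
    by (auto simp: Hom_def lim_def)
  note fam = Dom_family[OF q_Arr(1)[OF f]] Cod_family[OF q_Arr(1)[OF f]]
  show ?r
    unfolding c d p_\<phi>[OF fam(1)] p_\<phi>[OF fam(2)]
    using f \<phi>_lim[OF fam(1)] \<phi>_lim[OF fam(2)] compatible_familiesD(1)[OF q_Arr(1)[OF f]]
    by (simp add: Arr_Hom)
next
  assume r: ?r
  then have f: "f \<in> Arr lim" and c: "c \<in> Obj lim" and d: "d \<in> Obj lim" by auto
  note fam = Dom_family[OF q_Arr(1)[OF f]] Cod_family[OF q_Arr(1)[OF f]]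
  have "\<phi> (\<lambda>i\<in>Obj J. Dom (OMap D i) (q f i)) = c"
    by (rule lim_Obj_eqI[OF \<phi>_lim[OF fam(1)] c]) (use r in \<open>simp add: p_\<phi>[OF fam(1)] Hom_def\<close>)
  moreover have "\<phi> (\<lambda>i\<in>Obj J. Cod (OMap D i) (q f i)) = d"
    by (rule lim_Obj_eqI[OF \<phi>_lim[OF fam(2)] d]) (use r in \<open>simp add: p_\<phi>[OF fam(2)] Hom_def\<close>)
  ultimately show ?l
    using f by (simp add: Hom_def) (simp add: lim_def)
qed

lemma q_Ident:
  assumes "c \<in> Obj lim"
  shows "Ident lim c \<in> Arr lim" and "i \<in> Obj J \<Longrightarrow> q (Ident lim c) i = Ident (OMap D i) (p c i)"
  using \<psi>_lim[OF Ident_family[OF p_Obj(1)[OF assms]]] q_\<psi>[OF Ident_family[OF p_Obj(1)[OF assms]]]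
  by (simp_all add: lim_def)

text \<open>Decoding undoes encoding only on compatible families; composability makes the
  componentwise composite one.\<close>

lemma q_Comp:
  assumes f: "f \<in> Hom lim c d" and g: "g \<in> Hom lim d e"
  shows "Comp lim g f \<in> Arr lim" and "i \<in> Obj J \<Longrightarrow> q (Comp lim g f) i = Comp (OMap D i) (q g i) (q f i)"
proof -
  have "(\<lambda>i\<in>Obj J. Comp (OMap D i) (q g i) (q f i)) \<in> XA"
    using f g unfolding Hom_lim by (intro Comp_family q_Arr(1)) auto
  from \<psi>_lim[OF this] q_\<psi>[OF this]
  show "Comp lim g f \<in> Arr lim" "i \<in> Obj J \<Longrightarrow> q (Comp lim g f) i = Comp (OMap D i) (q g i) (q f i)"
    by (simp_all add: lim_def)
qed

lemma q_Hom: "f \<in> Hom lim c d \<Longrightarrow> i \<in> Obj J \<Longrightarrow> q f i \<in> Hom (OMap D i) (p c i) (p d i)"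
  by (simp add: Hom_lim)

lemma category_lim: "category lim"
proof
  fix f assume f: "f \<in> Arr lim"
  show "Dom lim f \<in> Obj lim" "Cod lim f \<in> Obj lim"
    using \<phi>_lim[OF Dom_family[OF q_Arr(1)[OF f]]] \<phi>_lim[OF Cod_family[OF q_Arr(1)[OF f]]]
    by (simp_all add: lim_def)
next
  fix c assume c: "c \<in> Obj lim"
  show "Ident lim c \<in> Hom lim c c"
    unfolding Hom_lim using c q_Ident[OF c] category.Ident_Hom[OF category_vertex]
      compatible_familiesD(1)[OF p_Obj(1)[OF c]] by simp
next
  fix f g c d e assume f: "f \<in> Hom lim c d" and g: "g \<in> Hom lim d e"
  show fg: "Comp lim g f \<in> Hom lim c e"
    unfolding Hom_lim
    using q_Comp[OF f g] category.Comp_Hom[OF category_vertex q_Hom[OF f] q_Hom[OF g]] f g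
    by (simp add: Hom_lim)
next
  fix f g h b c d e
  assume f: "f \<in> Hom lim b c" and g: "g \<in> Hom lim c d" and h: "h \<in> Hom lim d e"
  have comp: "Comp lim g f \<in> Hom lim b d" "Comp lim h g \<in> Hom lim c e"
    using q_Comp[OF f g] category.Comp_Hom[OF category_vertex q_Hom[OF f] q_Hom[OF g]]
      q_Comp[OF g h] category.Comp_Hom[OF category_vertex q_Hom[OF g] q_Hom[OF h]] f g h
    by (simp_all add: Hom_lim)
  show "Comp lim h (Comp lim g f) = Comp lim (Comp lim h g) f"
  proof (rule lim_Arr_eqI[OF q_Comp(1)[OF comp(1) h] q_Comp(1)[OF f comp(2)]])
    fix i assume i: "i \<in> Obj J"
    show "q (Comp lim h (Comp lim g f)) i = q (Comp lim (Comp lim h g) f) i"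
      using category.Comp_assoc[OF category_vertex[OF i] q_Hom[OF f i] q_Hom[OF g i] q_Hom[OF h i]]
      by (simp add: q_Comp(2)[OF comp(1) h i] q_Comp(2)[OF f comp(2) i] q_Comp(2)[OF f g i] q_Comp(2)[OF g h i])
  qed
next
  fix f c d assume f: "f \<in> Hom lim c d"
  then have c: "c \<in> Obj lim" and d: "d \<in> Obj lim" and fA: "f \<in> Arr lim" by (auto simp: Hom_lim)
  have id: "Ident lim c \<in> Hom lim c c" "Ident lim d \<in> Hom lim d d"
    unfolding Hom_lim using c d q_Ident[OF c] q_Ident[OF d] category.Ident_Hom[OF category_vertex]
      compatible_familiesD(1)[OF p_Obj(1)[OF c]] compatible_familiesD(1)[OF p_Obj(1)[OF d]] by simp_all
  show "Comp lim f (Ident lim c) = f"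
    by (rule lim_Arr_eqI[OF q_Comp(1)[OF id(1) f] fA])
      (simp add: q_Comp(2)[OF id(1) f] q_Ident(2)[OF c]
        category.Comp_Ident_right[OF category_vertex q_Hom[OF f]])
  show "Comp lim (Ident lim d) f = f"
    by (rule lim_Arr_eqI[OF q_Comp(1)[OF f id(2)] fA])
      (simp add: q_Comp(2)[OF f id(2)] q_Ident(2)[OF d]
        category.Comp_Ident_left[OF category_vertex q_Hom[OF f]])
qed

lemma proj_Hom:
  assumes i: "i \<in> Obj J"
  shows "proj i \<in> Hom small_Cat lim (OMap D i)"
proof -
  interpret E: category "OMap D i" using category_vertex[OF i] .
  interpret L: category lim by (rule category_lim)
  have A: "f \<in> Arr lim" if "f \<in> Hom lim c d" for f c d
    using that by (simp add: Hom_def)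
  have O: "c \<in> Obj lim" "d \<in> Obj lim" if "f \<in> Hom lim c d" for f c d
    using that by (simp_all add: Hom_lim)
  have "is_functor lim (OMap D i) (functor_of (proj i))"
  proof
    show "OMap (functor_of (proj i)) c \<in> Obj (OMap D i)" if "c \<in> Obj lim" for c
      using that compatible_familiesD(1)[OF p_Obj(1)[OF that] i] by (simp add: proj_def)
    show "AMap (functor_of (proj i)) f \<in> Hom (OMap D i) (OMap (functor_of (proj i)) c) (OMap (functor_of (proj i)) d)"
      if "f \<in> Hom lim c d" for f c d
      using q_Hom[OF that i] A[OF that] O[OF that] by (simp add: proj_def)
    show "AMap (functor_of (proj i)) (Ident lim c) = Ident (OMap D i) (OMap (functor_of (proj i)) c)"
      if "c \<in> Obj lim" for c
      using that q_Ident[OF that] i by (simp add: proj_def)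
    show "AMap (functor_of (proj i)) (Comp lim g f) =
      Comp (OMap D i) (AMap (functor_of (proj i)) g) (AMap (functor_of (proj i)) f)"
      if "f \<in> Hom lim c d" "g \<in> Hom lim d e" for f g c d e
      using q_Comp[OF that] i A[OF that(1)] A[OF that(2)] by (simp add: proj_def)
  qed
  then show ?thesis
    unfolding Hom_small_Cat by (simp add: proj_def)
qed

text \<open>Compatibility of the decoded families is exactly the cone equation.\<close>

lemma proj_is_cone: "is_cone J small_Cat D lim proj"
  unfolding is_cone_def
proof (intro conjI ballI proj_Hom)
  show "lim \<in> Obj small_Cat" by (simp add: category_lim)
  fix u assume u: "u \<in> Arr J"
  show "Comp small_Cat (AMap D u) (proj (Dom J u)) = proj (Cod J u)"
    by (rule Comp_small_Cat_eqI[OF proj_Hom[OF source.Dom_Obj[OF u]] AMap_Hom[OF Arr_Hom[OF u]]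
          proj_Hom[OF source.Cod_Obj[OF u]]])
      (simp_all add: proj_def compatible_familiesD(2)[OF p_Obj(1) u] compatible_familiesD(2)[OF q_Arr(1) u])
qed

section \<open>Universal property of the explicit limit\<close>

definition lift :: "('o, 'a) category \<Rightarrow> ('j \<Rightarrow> ('o, 'a) functor_arrow) \<Rightarrow> ('o, 'a) functor_arrow" where
  "lift X \<rho> = (X,
     \<lparr>OMap = (\<lambda>c\<in>Obj X. \<phi> (\<lambda>i\<in>Obj J. OMap (functor_of (\<rho> i)) c)),
      AMap = (\<lambda>f\<in>Arr X. \<psi> (\<lambda>i\<in>Obj J. AMap (functor_of (\<rho> i)) f))\<rparr>, lim)"

context
  fixes X \<rho> assumes cone: "is_cone J small_Cat D X \<rho>"
begin

lemma cone_leg: "i \<in> Obj J \<Longrightarrow> \<rho> i \<in> Hom small_Cat X (OMap D i)"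
  using cone by (simp add: is_cone_def)

lemma cone_functor: "i \<in> Obj J \<Longrightarrow> is_functor X (OMap D i) (functor_of (\<rho> i))"
  using cone_leg[of i] unfolding Hom_small_Cat by blast

text \<open>Evaluating the cone equations at a fixed object or arrow of \<open>X\<close> gives the
  compatibility conditions.\<close>

lemma cone_families:
  "c \<in> Obj X \<Longrightarrow> (\<lambda>i\<in>Obj J. OMap (functor_of (\<rho> i)) c) \<in> XO"
  "f \<in> Arr X \<Longrightarrow> (\<lambda>i\<in>Obj J. AMap (functor_of (\<rho> i)) f) \<in> XA"
proof -
  have nat: "Comp small_Cat (AMap D u) (\<rho> (Dom J u)) = \<rho> (Cod J u)" if "u \<in> Arr J" for u
    using cone that by (simp add: is_cone_def)
  show "(\<lambda>i\<in>Obj J. OMap (functor_of (\<rho> i)) c) \<in> XO" if "c \<in> Obj X"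
    unfolding compatible_families_iff[OF source.category_axioms]
  proof (intro conjI ballI)
    show "OMap (functor_of (\<rho> i)) c \<in> Obj (OMap D i)" if "i \<in> Obj J" for i
      using is_functor.OMap_Obj[OF cone_functor[OF that] \<open>c \<in> Obj X\<close>] .
    fix u assume u: "u \<in> Arr J"
    show "OMap (functor_of (AMap D u)) (OMap (functor_of (\<rho> (Dom J u))) c) = OMap (functor_of (\<rho> (Cod J u))) c"
      using functor_of_Comp(1)[OF cone_leg[OF source.Dom_Obj[OF u]] AMap_Hom[OF Arr_Hom[OF u]] that] nat[OF u]
      by simp
  qed
  show "(\<lambda>i\<in>Obj J. AMap (functor_of (\<rho> i)) f) \<in> XA" if "f \<in> Arr X"
    unfolding compatible_families_iff[OF source.category_axioms]
  proof (intro conjI ballI)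
    show "AMap (functor_of (\<rho> i)) f \<in> Arr (OMap D i)" if "i \<in> Obj J" for i
      using is_functor.AMap_Arr(1)[OF cone_functor[OF that] \<open>f \<in> Arr X\<close>] .
    fix u assume u: "u \<in> Arr J"
    show "AMap (functor_of (AMap D u)) (AMap (functor_of (\<rho> (Dom J u))) f) = AMap (functor_of (\<rho> (Cod J u))) f"
      using functor_of_Comp(2)[OF cone_leg[OF source.Dom_Obj[OF u]] AMap_Hom[OF Arr_Hom[OF u]] that] nat[OF u]
      by simp
  qed
qed

lemma lift_OMap:
  assumes "c \<in> Obj X"
  shows "OMap (functor_of (lift X \<rho>)) c \<in> Obj lim"
    and "i \<in> Obj J \<Longrightarrow> p (OMap (functor_of (lift X \<rho>)) c) i = OMap (functor_of (\<rho> i)) c"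
  using assms \<phi>_lim[OF cone_families(1)[OF assms]] by (simp_all add: lift_def p_\<phi>[OF cone_families(1)])

lemma lift_AMap:
  assumes "f \<in> Arr X"
  shows "AMap (functor_of (lift X \<rho>)) f \<in> Arr lim"
    and "i \<in> Obj J \<Longrightarrow> q (AMap (functor_of (lift X \<rho>)) f) i = AMap (functor_of (\<rho> i)) f"
  using assms \<psi>_lim[OF cone_families(2)[OF assms]] by (simp_all add: lift_def q_\<psi>[OF cone_families(2)])

text \<open>Componentwise, each functor law for the lift is the same law for a leg of the
  cone.\<close>

lemma lift_Hom: "lift X \<rho> \<in> Hom small_Cat X lim"
proof -
  interpret X: category X using cone by (simp add: is_cone_def)
  interpret L: category lim by (rule category_lim)
  have H: "AMap (functor_of (lift X \<rho>)) f \<in>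
      Hom lim (OMap (functor_of (lift X \<rho>)) c) (OMap (functor_of (lift X \<rho>)) d)"
    if f: "f \<in> Hom X c d" for f c d
    unfolding Hom_lim
    using lift_AMap[OF Hom_Dom_Cod(1)[OF X.category_axioms f]]
      lift_OMap[OF Hom_Dom_Cod(4)[OF X.category_axioms f]]
      lift_OMap[OF Hom_Dom_Cod(5)[OF X.category_axioms f]] is_functor.AMap_Hom[OF cone_functor f]
    by simp
  have "is_functor X lim (functor_of (lift X \<rho>))"
  proof
    show "OMap (functor_of (lift X \<rho>)) c \<in> Obj lim" if "c \<in> Obj X" for c
      using lift_OMap(1)[OF that] .
    show "AMap (functor_of (lift X \<rho>)) f \<in>
        Hom lim (OMap (functor_of (lift X \<rho>)) c) (OMap (functor_of (lift X \<rho>)) d)"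
      if "f \<in> Hom X c d" for f c d
      using H[OF that] .
    show "AMap (functor_of (lift X \<rho>)) (Ident X c) = Ident lim (OMap (functor_of (lift X \<rho>)) c)"
      if c: "c \<in> Obj X" for c
    proof -
      have id: "Ident X c \<in> Arr X" using X.Ident_Hom[OF c] by (simp add: Hom_def)
      show ?thesis
        by (rule lim_Arr_eqI[OF lift_AMap(1)[OF id] q_Ident(1)[OF lift_OMap(1)[OF c]]])
          (simp add: lift_AMap(2)[OF id] q_Ident(2)[OF lift_OMap(1)[OF c]] lift_OMap(2)[OF c]
            is_functor.AMap_Ident[OF cone_functor c])
    qed
    show "AMap (functor_of (lift X \<rho>)) (Comp X g f) =
      Comp lim (AMap (functor_of (lift X \<rho>)) g) (AMap (functor_of (lift X \<rho>)) f)"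
      if f: "f \<in> Hom X c d" and g: "g \<in> Hom X d e" for f g c d e
    proof -
      have A: "f \<in> Arr X" "g \<in> Arr X" "Comp X g f \<in> Arr X"
        using f g X.Comp_Hom[OF f g] by (simp_all add: Hom_def)
      show ?thesis
        by (rule lim_Arr_eqI[OF lift_AMap(1)[OF A(3)] q_Comp(1)[OF H[OF f] H[OF g]]])
          (simp add: lift_AMap(2)[OF A(1)] lift_AMap(2)[OF A(2)] lift_AMap(2)[OF A(3)]
            q_Comp(2)[OF H[OF f] H[OF g]] is_functor.AMap_Comp[OF cone_functor f g])
    qed
  qed
  then show ?thesis
    unfolding Hom_small_Cat by (simp add: lift_def)
qed

lemma proj_lift:
  assumes i: "i \<in> Obj J"
  shows "Comp small_Cat (proj i) (lift X \<rho>) = \<rho> i"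
  by (rule Comp_small_Cat_eqI[OF lift_Hom proj_Hom[OF i] cone_leg[OF i]])
    (simp_all add: proj_def lift_OMap lift_AMap i)

text \<open>The equations with the projections prescribe every component of every value of
  \<open>h\<close>, and components determine objects and arrows of \<open>lim\<close>.\<close>

lemma lift_unique:
  assumes h: "h \<in> Hom small_Cat X lim" and eq: "\<And>i. i \<in> Obj J \<Longrightarrow> Comp small_Cat (proj i) h = \<rho> i"
  shows "h = lift X \<rho>"
proof (rule small_Cat_arrow_eqI[OF h lift_Hom])
  interpret h: is_functor X lim "functor_of h" using h unfolding Hom_small_Cat by blast
  show "OMap (functor_of h) c = OMap (functor_of (lift X \<rho>)) c" if c: "c \<in> Obj X" for c
  proof (rule lim_Obj_eqI[OF h.OMap_Obj[OF c] lift_OMap(1)[OF c]])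
    show "p (OMap (functor_of h) c) i = p (OMap (functor_of (lift X \<rho>)) c) i" if i: "i \<in> Obj J" for i
      using functor_of_Comp(1)[OF h proj_Hom[OF i] c] h.OMap_Obj[OF c]
      unfolding eq[OF i] lift_OMap(2)[OF c i] by (simp add: proj_def)
  qed
  show "AMap (functor_of h) f = AMap (functor_of (lift X \<rho>)) f" if f: "f \<in> Arr X" for f
  proof (rule lim_Arr_eqI[OF h.AMap_Arr(1)[OF f] lift_AMap(1)[OF f]])
    show "q (AMap (functor_of h) f) i = q (AMap (functor_of (lift X \<rho>)) f) i" if i: "i \<in> Obj J" for i
      using functor_of_Comp(2)[OF h proj_Hom[OF i] f] h.AMap_Arr(1)[OF f]
      unfolding eq[OF i] lift_AMap(2)[OF f i] by (simp add: proj_def)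
  qed
qed

end

theorem is_limit_lim: "is_limit J small_Cat D lim proj"
  unfolding is_limit_def
proof (intro conjI allI impI proj_is_cone)
  fix X \<rho> assume cone: "is_cone J small_Cat D X \<rho>"
  show "\<exists>!h. h \<in> Hom small_Cat X lim \<and> (\<forall>i\<in>Obj J. Comp small_Cat (proj i) h = \<rho> i)"
  proof (rule ex1I[of _ "lift X \<rho>"])
    show "lift X \<rho> \<in> Hom small_Cat X lim \<and>
        (\<forall>i\<in>Obj J. Comp small_Cat (proj i) (lift X \<rho>) = \<rho> i)"
      by (intro conjI ballI lift_Hom[OF cone] proj_lift[OF cone])
    show "h = lift X \<rho>"
      if "h \<in> Hom small_Cat X lim \<and> (\<forall>i\<in>Obj J. Comp small_Cat (proj i) h = \<rho> i)" for h
      by (rule lift_unique[OF cone]) (use that in blast)+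
  qed
qed

end

section \<open>Existence of limits of finite categories and the closure result\<close>

lemma finite_inj_on_infinite:
  assumes "finite A" and "infinite (UNIV :: 'b set)"
  shows "\<exists>f :: 'a \<Rightarrow> 'b. inj_on f A"
proof -
  obtain B :: "'b set" where "finite B" "card B = card A"
    using infinite_arbitrarily_large[OF assms(2)] by blast
  then obtain f where "bij_betw f A B"
    using finite_same_card_bij[OF assms(1)] by metis
  then show ?thesis
    by (auto simp: bij_betw_def)
qed

text \<open>Finitely many finite vertices admit only finitely many compatible families, so
  injections \<open>\<phi>\<close> and \<open>\<psi>\<close> into the infinite universe types exist
  and the encoded limit can be formed.\<close>

lemma small_Cat_has_finite_limits_of_finite_categories:
  fixes D :: "('j, 'k, ('o, 'a) category, ('o, 'a) functor_arrow) functor_maps"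
  assumes infO: "infinite (UNIV :: 'o set)" and infA: "infinite (UNIV :: 'a set)"
    and fin: "finite (Obj J)" and D: "is_functor J small_Cat D"
    and finE: "\<And>i. i \<in> Obj J \<Longrightarrow> finite_category (OMap D i)"
  shows "\<exists>L \<pi>. is_limit J small_Cat D L \<pi>"
proof -
  interpret D: is_functor J small_Cat D by fact
  have finO: "finite (Obj (OMap D i))" and finA: "finite (Arr (OMap D i))" if "i \<in> Obj J" for i
    using finE[OF that] by (simp_all add: finite_category_def)
  obtain \<phi> :: "('j \<Rightarrow> 'o) \<Rightarrow> 'o"
    where \<phi>: "inj_on \<phi> (compatible_families J (\<lambda>i. Obj (OMap D i)) (\<lambda>u. OMap (functor_of (AMap D u))))"
    using finite_inj_on_infinite[OF finite_compatible_families
        [where S = "\<lambda>i. Obj (OMap D i)"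
          and T = "\<lambda>u. OMap (functor_of (AMap D u))", OF fin finO] infO] by blast
  obtain \<psi> :: "('j \<Rightarrow> 'a) \<Rightarrow> 'a"
    where \<psi>: "inj_on \<psi> (compatible_families J (\<lambda>i. Arr (OMap D i)) (\<lambda>u. AMap (functor_of (AMap D u))))"
    using finite_inj_on_infinite[OF finite_compatible_families
        [where S = "\<lambda>i. Arr (OMap D i)"
          and T = "\<lambda>u. AMap (functor_of (AMap D u))", OF fin finA] infA] by blast
  interpret encoded_families J D \<phi> \<psi> by unfold_locales (fact \<phi>, fact \<psi>)
  show ?thesis using is_limit_lim by blast
qed

theorem proposition5p20:
  fixes J :: "('j, 'k) category"
  assumes "infinite (UNIV :: 'o set)" and "infinite (UNIV :: 'a set)"
    and "infinite (UNIV :: 's set)"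
    and "finite_category J"
  shows "closed_under_limits J (small_Cat :: (('o, 'a) category, ('o, 'a) functor_arrow) category)
           (\<lambda>C. finite_category C \<and> acyclic_category C \<and> monic_category C \<and>
                left_locally_totally_ordered C)
       \<and> (\<forall>D L \<pi>. is_functor J (small_Cat :: (('o, 'a) category, ('o, 'a) functor_arrow) category) D
              \<and> (\<forall>i \<in> Obj J. finite_category (OMap D i) \<and> acyclic_category (OMap D i) \<and>
                    weakly_word_embeddable TYPE('s) (OMap D i))
              \<and> is_limit J small_Cat D L \<pi>
            \<longrightarrow> weakly_word_embeddable TYPE('s) L)"
proof (intro conjI allI impI)
  have fin: "finite (Obj J)"
    using assms(4) by (simp add: finite_category_def)
  note faithful_legs = is_limit_small_Cat_jointly_faithful[OF assms(1,2) fin]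
  show "closed_under_limits J (small_Cat :: (('o, 'a) category, ('o, 'a) functor_arrow) category)
    (\<lambda>C. finite_category C \<and> acyclic_category C \<and> monic_category C \<and> left_locally_totally_ordered C)"
    unfolding closed_under_limits_def
  proof (intro allI impI conjI)
    fix D :: "('j, 'k, ('o, 'a) category, ('o, 'a) functor_arrow) functor_maps"
    assume D: "is_functor J small_Cat D \<and> (\<forall>i\<in>Obj J. finite_category (OMap D i) \<and>
      acyclic_category (OMap D i) \<and> monic_category (OMap D i) \<and> left_locally_totally_ordered (OMap D i))"
    show "\<exists>L \<pi>. is_limit J small_Cat D L \<pi>"
      by (rule small_Cat_has_finite_limits_of_finite_categories[OF assms(1,2) fin]) (use D in auto)
    fix L \<pi> assume lim: "is_limit J small_Cat D L \<pi>"
    \<comment> \<open>The limit is arbitrary here: any limit cone has separating legs, so the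
      properties pass from the vertices to \<open>L\<close> without comparison to the explicit
      construction.\<close>
    interpret jointly_faithful L "Obj J" "OMap D" "\<lambda>i. functor_of (\<pi> i)"
      using faithful_legs[OF _ lim] D by blast
    show "finite_category L" by (rule finite_category_source) (use D in blast)
    show "acyclic_category L" by (rule acyclic_category_source) (use D in blast)
    show "monic_category L" by (rule monic_category_source) (use D in blast)
    show "left_locally_totally_ordered L" by (rule left_locally_totally_ordered_source) (use D in blast)
  qed
  fix D :: "('j, 'k, ('o, 'a) category, ('o, 'a) functor_arrow) functor_maps" and L \<pi>
  assume D: "is_functor J small_Cat D \<and>
    (\<forall>i\<in>Obj J. finite_category (OMap D i) \<and> acyclic_category (OMap D i) \<and>
      weakly_word_embeddable TYPE('s) (OMap D i)) \<and> is_limit J small_Cat D L \<pi>"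
  interpret jointly_faithful L "Obj J" "OMap D" "\<lambda>i. functor_of (\<pi> i)"
    using faithful_legs D by blast
  show "weakly_word_embeddable TYPE('s) L"
    by (rule weakly_word_embeddable_source[OF assms(3)]) (use D in blast)
qed

end
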